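(* Let $k$ be a commutative ring, $A$ a dg $k$-algebra and $\phi\in A^2$ a central element with $d_A(\phi)=0$. Let $A_\phi[\epsilon]$ be the cdg $k[\epsilon]$-algebra $A[\epsilon]=A\otimes_k k[\epsilon]$ (with $\epsilon^2=0$, $|\epsilon|=0$) with the $\epsilon$-linearly extended multiplication and predifferential of $A$ and with curvature $c=\phi\epsilon$. Then the "derived" category $D_{\phi,\epsilon}(A_\phi[\epsilon])$ deforms $D_{\phi,0}(A)$.
   Context: A cdg algebra is a $\mathbb{Z}$-graded (associative, unital) algebra $B$ with a degree $1$ graded derivation $d_B$ (the predifferential) and an element $c\in B^2$ (the curvature) with $d_B(c)=0$ and $d_B^2(b)=cb-bc$; a dg algebra is a cdg algebra with $c=0$. A cdg $B$-module is a graded left $B$-module $M$ with a degree $1$ map $d_M$ such that $d_M(bm)=d_B(b)m+(-1)^{|b|}b\,d_M(m)$ and $d_M^2(m)=cm$; these form $\mathsf{Mod}(B)$, and the homotopy category $\underline{\mathsf{Mod}}(B)$ has the same objects, with morphisms the degree $0$ $B$-linear maps commuting with predifferentials modulo those of the form $dh+hd$, $h$ graded $B$-linear of degree $-1$. Shift: $M[i]^j=M^{i+j}$, $d_{M[i]}=(-1)^id_M$, with $b$ acting on $M[i]$ as $(-1)^{i|b|}b$. Let $B$ be a cdg algebra with $d_B^2=0$, and let $\phi\in B^2$, $\varphi\in B^0$ be central elements with $d_B\phi=d_B\varphi=0$ and $\phi\varphi=c$ (a splitting of $B$). Then $B_{\phi,\varphi}$ is the cdg $B$-module with underlying graded module $B\oplus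 B[-1]$ and predifferential $$d(a,b)=(d_B(a)+b\phi,\;-d_B(b)+a\varphi).$$ A module $N\in\mathsf{Mod}(B)$ is called $B_{\phi,\varphi}$-acyclic if $\underline{\mathsf{Mod}}(B)(B_{\phi,\varphi}[i],N)=0$ for all $i\in\mathbb{Z}$, and $D_{\phi,\varphi}(B)$ is the triangle quotient of $\underline{\mathsf{Mod}}(B)$ by the thick subcategory of $B_{\phi,\varphi}$-acyclic modules. In the claim, $D_{\phi,\epsilon}(A_\phi[\epsilon])$ is this category for $B=A_\phi[\epsilon]$ and the pair $(\phi,\epsilon)$, and $D_{\phi,0}(A)$ is this category for $B=A$ and the pair $(\phi,0)$. "$D_{\phi,\epsilon}(A_\phi[\epsilon])$ deforms $D_{\phi,0}(A)$" means: a dg $A$-module $N$ is $A_{\phi,0}$-acyclic if and only if $N$, regarded as a cdg $A_\phi[\epsilon]$-module by restriction of scalars along $A_\phi[\epsilon]\to A$, $\epsilon\mapsto0$, is $A_\phi[\epsilon]_{\phi,\epsilon}$-acyclic. *)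

theory Defs
  imports "HOL-Algebra.Module" "HOL-Algebra.Coset" "HOL-Algebra.AbelCoset"
begin

text \<open>
  A graded object is an additive group together with its subgroups of homogeneous elements, of which
  it is the internal direct sum. The record extends the library's module record; as there, the ring
  multiplication and unit of the record play no role for a module.
\<close>

record ('r, 'm) pdg_module = "('r, 'm) module" +
  grade :: "int \<Rightarrow> 'm set"
  pdiff :: "'m \<Rightarrow> 'm"

record ('k, 'b) cdg_algebra = "('k, 'b) pdg_module" +
  curv :: 'b

definition decomposition :: "('r, 'm, 'z) pdg_module_scheme \<Rightarrow> 'm \<Rightarrow> (int \<Rightarrow> 'm) \<Rightarrow> bool" where
  "decomposition M x f \<longleftrightarrow>
     (\<forall>i. f i \<in> grade M i) \<and> finite {i. f i \<noteq> \<zero>\<^bsub>M\<^esub>} \<and> x = (\<Oplus>\<^bsub>M\<^esub>i\<in>{i. f i \<noteq> \<zero>\<^bsub>M\<^esub>}. f i)"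

definition component :: "('r, 'm, 'z) pdg_module_scheme \<Rightarrow> int \<Rightarrow> 'm \<Rightarrow> 'm" where
  "component M i x = (THE f. decomposition M x f) i"

definition sgn_mult :: "('m, 'z) ring_scheme \<Rightarrow> int \<Rightarrow> 'm \<Rightarrow> 'm" where
  "sgn_mult M n x = (if even n then x else \<ominus>\<^bsub>M\<^esub> x)"

locale graded_group = abelian_group M for M (structure) +
  assumes grade_subgroup: "additive_subgroup (grade M i) M"
    and decomposition_ex1: "x \<in> carrier M \<Longrightarrow> \<exists>!f. decomposition M x f"

locale graded_ring = ring B + graded_group B for B (structure) +
  assumes grade_one: "\<one> \<in> grade B 0"
    and grade_mult: "\<lbrakk>a \<in> grade B i; b \<in> grade B j\<rbrakk> \<Longrightarrow> a \<otimes> b \<in> grade B (i + j)"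

locale cdg_ring = graded_ring B for B (structure) +
  assumes pdiff_add: "\<lbrakk>a \<in> carrier B; b \<in> carrier B\<rbrakk> \<Longrightarrow> pdiff B (a \<oplus> b) = pdiff B a \<oplus> pdiff B b"
    and pdiff_grade: "a \<in> grade B i \<Longrightarrow> pdiff B a \<in> grade B (i + 1)"
    and pdiff_mult: "\<lbrakk>a \<in> grade B i; b \<in> carrier B\<rbrakk> \<Longrightarrow>
      pdiff B (a \<otimes> b) = pdiff B a \<otimes> b \<oplus> sgn_mult B i (a \<otimes> pdiff B b)"
    and curv_grade: "curv B \<in> grade B 2"
    and pdiff_curv: "pdiff B (curv B) = \<zero>"
    and pdiff_pdiff: "b \<in> carrier B \<Longrightarrow>
      pdiff B (pdiff B b) = curv B \<otimes> b \<ominus> b \<otimes> curv B"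

locale cdg_algebra = module K B + cdg_ring B for K and B (structure) +
  assumes smult_mult_left: "\<lbrakk>s \<in> carrier K; a \<in> carrier B; b \<in> carrier B\<rbrakk> \<Longrightarrow>
      (s \<odot> a) \<otimes> b = s \<odot> (a \<otimes> b)"
    and smult_mult_right: "\<lbrakk>s \<in> carrier K; a \<in> carrier B; b \<in> carrier B\<rbrakk> \<Longrightarrow>
      a \<otimes> (s \<odot> b) = s \<odot> (a \<otimes> b)"
    and smult_grade: "\<lbrakk>s \<in> carrier K; a \<in> grade B i\<rbrakk> \<Longrightarrow> s \<odot> a \<in> grade B i"
    and pdiff_smult: "\<lbrakk>s \<in> carrier K; a \<in> carrier B\<rbrakk> \<Longrightarrow> pdiff B (s \<odot> a) = s \<odot> pdiff B a"

locale dg_algebra = cdg_algebra K A for K and A (structure) +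
  assumes curv_zero: "curv A = \<zero>"

text \<open>
  No ground ring occurs here: a module over a \<open>K\<close>-algebra \<open>B\<close> is a \<open>K\<close>-module by restriction along
  \<open>K \<rightarrow> B\<close>, and \<open>K\<close>-linearity of its predifferential follows from the Leibniz rule because
  the predifferential of \<open>B\<close> vanishes on the image of \<open>K\<close>.
\<close>

locale cdg_module = B: cdg_ring B + graded_group M for B and M (structure) +
  assumes smult_closed: "\<lbrakk>b \<in> carrier B; x \<in> carrier M\<rbrakk> \<Longrightarrow> b \<odot> x \<in> carrier M"
    and smult_l_distr: "\<lbrakk>a \<in> carrier B; b \<in> carrier B; x \<in> carrier M\<rbrakk> \<Longrightarrow>
      (a \<oplus>\<^bsub>B\<^esub> b) \<odot> x = a \<odot> x \<oplus> b \<odot> x"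
    and smult_r_distr: "\<lbrakk>b \<in> carrier B; x \<in> carrier M; y \<in> carrier M\<rbrakk> \<Longrightarrow>
      b \<odot> (x \<oplus> y) = b \<odot> x \<oplus> b \<odot> y"
    and smult_assoc: "\<lbrakk>a \<in> carrier B; b \<in> carrier B; x \<in> carrier M\<rbrakk> \<Longrightarrow>
      (a \<otimes>\<^bsub>B\<^esub> b) \<odot> x = a \<odot> (b \<odot> x)"
    and smult_one: "x \<in> carrier M \<Longrightarrow> \<one>\<^bsub>B\<^esub> \<odot> x = x"
    and smult_grade: "\<lbrakk>b \<in> grade B i; x \<in> grade M j\<rbrakk> \<Longrightarrow> b \<odot> x \<in> grade M (i + j)"
    and pdiff_add: "\<lbrakk>x \<in> carrier M; y \<in> carrier M\<rbrakk> \<Longrightarrow> pdiff M (x \<oplus> y) = pdiff M x \<oplus> pdiff M y"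
    and pdiff_grade: "x \<in> grade M i \<Longrightarrow> pdiff M x \<in> grade M (i + 1)"
    and pdiff_smult: "\<lbrakk>b \<in> grade B i; x \<in> carrier M\<rbrakk> \<Longrightarrow>
      pdiff M (b \<odot> x) = pdiff B b \<odot> x \<oplus> sgn_mult M i (b \<odot> pdiff M x)"
    and pdiff_pdiff: "x \<in> carrier M \<Longrightarrow> pdiff M (pdiff M x) = curv B \<odot> x"

text \<open>The additive map with $b \mapsto (-1)^{i|b|} b$ on homogeneous elements.\<close>

definition sgn_twist :: "('k, 'b, 'z) pdg_module_scheme \<Rightarrow> int \<Rightarrow> 'b \<Rightarrow> 'b" where
  "sgn_twist B i b =
     (\<Oplus>\<^bsub>B\<^esub>j\<in>{j. component B j b \<noteq> \<zero>\<^bsub>B\<^esub>}. sgn_mult B (i * j) (component B j b))"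

definition shift ::
  "('k, 'b, 'z) pdg_module_scheme \<Rightarrow> int \<Rightarrow> ('b, 'm) pdg_module \<Rightarrow> ('b, 'm) pdg_module" where
  "shift B i M = M\<lparr>smult := \<lambda>b x. sgn_twist B i b \<odot>\<^bsub>M\<^esub> x,
     grade := \<lambda>j. grade M (i + j), pdiff := \<lambda>x. sgn_mult M i (pdiff M x)\<rparr>"

definition restrict_scalars :: "('b \<Rightarrow> 'c) \<Rightarrow> ('c, 'm) pdg_module \<Rightarrow> ('b, 'm) pdg_module" where
  "restrict_scalars f N = \<lparr>carrier = carrier N, mult = mult N, one = one N, zero = zero N,
     add = add N, smult = \<lambda>b x. f b \<odot>\<^bsub>N\<^esub> x, grade = grade N, pdiff = pdiff N\<rparr>"

text \<open>
  The algebra as a left module over itself; for nonzero curvature this is a graded module with a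
  predifferential, but not a cdg module.
\<close>

definition regular_module :: "('k, 'b, 'z) pdg_module_scheme \<Rightarrow> ('b, 'b) pdg_module" where
  "regular_module B = \<lparr>carrier = carrier B, mult = mult B, one = one B, zero = zero B,
     add = add B, smult = mult B, grade = grade B, pdiff = pdiff B\<rparr>"

definition direct_sum ::
  "('b, 'm) pdg_module \<Rightarrow> ('b, 'n) pdg_module \<Rightarrow> ('b, 'm \<times> 'n) pdg_module" where
  "direct_sum M N = \<lparr>carrier = carrier M \<times> carrier N, mult = undefined, one = undefined,
     zero = (\<zero>\<^bsub>M\<^esub>, \<zero>\<^bsub>N\<^esub>), add = \<lambda>(x, y) (x', y'). (x \<oplus>\<^bsub>M\<^esub> x', y \<oplus>\<^bsub>N\<^esub> y'),
     smult = \<lambda>b (x, y). (b \<odot>\<^bsub>M\<^esub> x, b \<odot>\<^bsub>N\<^esub> y),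
     grade = \<lambda>i. grade M i \<times> grade N i, pdiff = \<lambda>(x, y). (pdiff M x, pdiff N y)\<rparr>"

locale cdg_splitting = cdg_ring B for B (structure) and \<phi> \<psi> +
  assumes pdiff_squared: "b \<in> carrier B \<Longrightarrow> pdiff B (pdiff B b) = \<zero>"
    and phi_grade: "\<phi> \<in> grade B 2"
    and psi_grade: "\<psi> \<in> grade B 0"
    and phi_central: "b \<in> carrier B \<Longrightarrow> \<phi> \<otimes> b = b \<otimes> \<phi>"
    and psi_central: "b \<in> carrier B \<Longrightarrow> \<psi> \<otimes> b = b \<otimes> \<psi>"
    and pdiff_phi: "pdiff B \<phi> = \<zero>"
    and pdiff_psi: "pdiff B \<psi> = \<zero>"
    and curv_splitting: "\<phi> \<otimes> \<psi> = curv B"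

definition splitting_module ::
  "('k, 'b, 'z) pdg_module_scheme \<Rightarrow> 'b \<Rightarrow> 'b \<Rightarrow> ('b, 'b \<times> 'b) pdg_module" where
  "splitting_module B \<phi> \<psi> = (direct_sum (regular_module B) (shift B (- 1) (regular_module B)))
     \<lparr>pdiff := \<lambda>(a, b). (pdiff B a \<oplus>\<^bsub>B\<^esub> b \<otimes>\<^bsub>B\<^esub> \<phi>, \<ominus>\<^bsub>B\<^esub> pdiff B b \<oplus>\<^bsub>B\<^esub> a \<otimes>\<^bsub>B\<^esub> \<psi>)\<rparr>"

text \<open>
  Graded \<open>B\<close>-linear maps of degree \<open>i\<close>, with the Koszul sign that makes them the same as the
  degree 0 maps into the shift by \<open>i\<close>; without it $dh + hd$ would not be \<open>B\<close>-linear
  for \<open>h\<close> of degree -1. Maps are extensional, so that equality of morphisms is equality on the carrier.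
\<close>

definition graded_hom :: "('k, 'b, 'z) pdg_module_scheme \<Rightarrow> int \<Rightarrow>
    ('b, 'm) pdg_module \<Rightarrow> ('b, 'n) pdg_module \<Rightarrow> ('m \<Rightarrow> 'n) set" where
  "graded_hom B i M N = {f \<in> carrier M \<rightarrow>\<^sub>E carrier N.
     (\<forall>x\<in>carrier M. \<forall>y\<in>carrier M. f (x \<oplus>\<^bsub>M\<^esub> y) = f x \<oplus>\<^bsub>N\<^esub> f y) \<and>
     (\<forall>j. \<forall>x\<in>grade M j. f x \<in> grade N (j + i)) \<and>
     (\<forall>j. \<forall>b\<in>grade B j. \<forall>x\<in>carrier M. f (b \<odot>\<^bsub>M\<^esub> x) = sgn_mult N (i * j) (b \<odot>\<^bsub>N\<^esub> f x))}"

definition cdg_hom :: "('k, 'b, 'z) pdg_module_scheme \<Rightarrow>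
    ('b, 'm) pdg_module \<Rightarrow> ('b, 'n) pdg_module \<Rightarrow> ('m \<Rightarrow> 'n) monoid" where
  "cdg_hom B M N = \<lparr>carrier =
       {f \<in> graded_hom B 0 M N. \<forall>x\<in>carrier M. f (pdiff M x) = pdiff N (f x)},
     mult = \<lambda>f g. \<lambda>x\<in>carrier M. f x \<oplus>\<^bsub>N\<^esub> g x, one = \<lambda>x\<in>carrier M. \<zero>\<^bsub>N\<^esub>\<rparr>"

definition null_homotopic :: "('k, 'b, 'z) pdg_module_scheme \<Rightarrow>
    ('b, 'm) pdg_module \<Rightarrow> ('b, 'n) pdg_module \<Rightarrow> ('m \<Rightarrow> 'n) set" where
  "null_homotopic B M N =
     (\<lambda>h. \<lambda>x\<in>carrier M. pdiff N (h x) \<oplus>\<^bsub>N\<^esub> h (pdiff M x)) ` graded_hom B (- 1) M N"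

definition homotopy_hom :: "('k, 'b, 'z) pdg_module_scheme \<Rightarrow>
    ('b, 'm) pdg_module \<Rightarrow> ('b, 'n) pdg_module \<Rightarrow> ('m \<Rightarrow> 'n) set monoid" where
  "homotopy_hom B M N = cdg_hom B M N Mod null_homotopic B M N"

definition splitting_acyclic :: "('k, 'b, 'z) pdg_module_scheme \<Rightarrow> 'b \<Rightarrow> 'b \<Rightarrow>
    ('b, 'n) pdg_module \<Rightarrow> bool" where
  "splitting_acyclic B \<phi> \<psi> N \<longleftrightarrow>
     (\<forall>i. carrier (homotopy_hom B (shift B i (splitting_module B \<phi> \<psi>)) N) =
       {\<one>\<^bsub>homotopy_hom B (shift B i (splitting_module B \<phi> \<psi>)) N\<^esub>})"

text \<open>
  The pair \<open>(a, a')\<close> stands for $a + a'\epsilon$ with $\epsilon^2 = 0$; in particular the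
  curvature $\phi\epsilon$ of $A_\phi[\epsilon]$ is the pair \<open>(0, \<phi>)\<close>, and \<open>fst\<close> is
  the map $\epsilon \mapsto 0$.
\<close>

definition dual_numbers :: "('k, 'z) ring_scheme \<Rightarrow> ('k \<times> 'k) ring" where
  "dual_numbers K = \<lparr>carrier = carrier K \<times> carrier K,
     mult = \<lambda>(s, s') (t, t'). (s \<otimes>\<^bsub>K\<^esub> t, s \<otimes>\<^bsub>K\<^esub> t' \<oplus>\<^bsub>K\<^esub> s' \<otimes>\<^bsub>K\<^esub> t),
     one = (\<one>\<^bsub>K\<^esub>, \<zero>\<^bsub>K\<^esub>), zero = (\<zero>\<^bsub>K\<^esub>, \<zero>\<^bsub>K\<^esub>),
     add = \<lambda>(s, s') (t, t'). (s \<oplus>\<^bsub>K\<^esub> t, s' \<oplus>\<^bsub>K\<^esub> t')\<rparr>"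

definition curved_dual :: "('k, 'a) cdg_algebra \<Rightarrow> 'a \<Rightarrow> ('k \<times> 'k, 'a \<times> 'a) cdg_algebra" where
  "curved_dual A \<phi> = \<lparr>carrier = carrier (dual_numbers A), mult = mult (dual_numbers A),
     one = one (dual_numbers A), zero = zero (dual_numbers A), add = add (dual_numbers A),
     smult = \<lambda>(s, s') (a, a'). (s \<odot>\<^bsub>A\<^esub> a, s \<odot>\<^bsub>A\<^esub> a' \<oplus>\<^bsub>A\<^esub> s' \<odot>\<^bsub>A\<^esub> a),
     grade = \<lambda>i. grade A i \<times> grade A i, pdiff = \<lambda>(a, a'). (pdiff A a, pdiff A a'),
     curv = (\<zero>\<^bsub>A\<^esub>, \<phi>)\<rparr>"

definition eps :: "('a, 'z) ring_scheme \<Rightarrow> 'a \<times> 'a" where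
  "eps A = (\<zero>\<^bsub>A\<^esub>, \<one>\<^bsub>A\<^esub>)"

end

theory Submission
  imports Defs
begin

text \<open>
  The graded module underlying $B_{\phi,\psi}$ is free on the generators \<open>e\<^sub>0 = (1, 0)\<close> of degree 0 and
  \<open>e\<^sub>1 = (0, 1)\<close> of degree 1, with $d(e_0) = \psi e_1$ and $d(e_1) = \phi e_0$. A graded \<open>B\<close>-linear map
  out of it is therefore the same as the pair of its values on the generators
  (\<open>graded_hom_splitting_module\<close>), and the conditions that define morphisms and homotopies become
  equations between these values. With $s = (-1)^i$, a morphism from $B_{\phi,\psi}[i]$ to \<open>N\<close> is a pair
  $x \in N^{-i}$, $y \in N^{1-i}$ with
  $$d x = s \psi y, \qquad d y = s \phi x,$$
  and it is null homotopic if and only if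
  $$x = d u + s \psi v, \qquad y = d v + s \phi u$$
  for some $u \in N^{-i-1}$ and $v \in N^{-i}$. Both descriptions come from one formula for the commutator
  of a graded map with the predifferentials (\<open>pdiff_free_map\<close>), and together they give a criterion for
  acyclicity (\<open>homotopy_hom_trivial_iff\<close>) that refers to \<open>B\<close> only through the actions of \<open>\<phi>\<close> and
  \<open>\<psi>\<close> on \<open>N\<close>.

  Now let \<open>N\<close> be a dg \<open>A\<close>-module. For \<open>(A, \<phi>, 0)\<close> the terms with \<open>\<psi>\<close> vanish because \<open>\<psi> = 0\<close>. For
  $(A_\phi[\epsilon], \phi, \epsilon)$ they vanish because $\epsilon$ acts as zero on the restriction of
  \<open>N\<close>, on which \<open>\<phi>\<close> acts as before. So the two acyclicity conditions are literally the same equations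
  in \<open>N\<close>.

  Some care goes into signs. The shift twists the action of \<open>b\<close> by $(-1)^{i|b|}$, which on a sum of
  elements of different degrees is the additive map \<open>sgn_twist\<close>. In terms of it the value of a
  graded map on an arbitrary element $(a, b)$ has a closed formula (\<open>free_map\<close>) without homogeneous
  components, and because \<open>sgn_twist\<close> is multiplicative and commutes with the predifferential up to
  sign, the commutator can be computed directly from this formula.
\<close>

section \<open>Homogeneous components\<close>

text \<open>
  Summing over any finite set that contains the support, instead of the support itself, makes it
  possible to add decompositions with different supports.
\<close>

lemma decomposition_iff:
  fixes G (structure)
  assumes G: "abelian_monoid G" and sub: "\<And>i. grade G i \<subseteq> carrier G"
    and fin: "finite S" and supp: "\<And>i. i \<notin> S \<Longrightarrow> f i = \<zero>"
  shows "decomposition G x f \<longleftrightarrow> (\<forall>i. f i \<in> grade G i) \<and> x = (\<Oplus>i\<in>S. f i)"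
proof -
  interpret abelian_monoid G by fact
  have fin': "finite {i. f i \<noteq> \<zero>}" and le: "{i. f i \<noteq> \<zero>} \<subseteq> S"
    using fin supp by (auto intro: finite_subset)
  have "(\<Oplus>i\<in>{i. f i \<noteq> \<zero>}. f i) = (\<Oplus>i\<in>S. f i)" if "\<forall>i. f i \<in> grade G i"
    by (rule add.finprod_mono_neutral_cong_left) (use fin le that sub in auto)
  with fin' show ?thesis
    unfolding decomposition_def by auto
qed

context graded_group
begin

lemma grade_subset: "grade M i \<subseteq> carrier M"
  using additive_subgroup.a_subset[OF grade_subgroup] .

lemma grade_closed: "x \<in> grade M i \<Longrightarrow> x \<in> carrier M"
  using grade_subset by blast

lemma zero_grade [simp]: "\<zero> \<in> grade M i"
  using additive_subgroup.zero_closed[OF grade_subgroup] .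

lemma add_grade: "\<lbrakk>x \<in> grade M i; y \<in> grade M i\<rbrakk> \<Longrightarrow> x \<oplus> y \<in> grade M i"
  using additive_subgroup.a_closed[OF grade_subgroup] .

lemma neg_grade: "x \<in> grade M i \<Longrightarrow> \<ominus> x \<in> grade M i"
  using additive_subgroup.a_inv_closed[OF grade_subgroup] .

lemma component_decomposition:
  assumes "x \<in> carrier M"
  shows "decomposition M x (\<lambda>i. component M i x)"
  unfolding component_def using theI'[OF decomposition_ex1[OF assms]] by simp

lemma component_eqI:
  assumes "decomposition M x f"
  shows "component M i x = f i"
proof -
  have "x \<in> carrier M"
    using assms grade_subset unfolding decomposition_def by (auto intro!: finsum_closed)
  then show ?thesis
    using decomposition_ex1[of x] assms unfolding component_def by (metis the1_equality)
qed

lemma component_grade: "x \<in> carrier M \<Longrightarrow> component M i x \<in> grade M i"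
  using component_decomposition unfolding decomposition_def by blast

lemma component_closed: "x \<in> carrier M \<Longrightarrow> component M i x \<in> carrier M"
  using component_grade grade_closed by blast

lemma finite_support: "x \<in> carrier M \<Longrightarrow> finite {i. component M i x \<noteq> \<zero>}"
  using component_decomposition unfolding decomposition_def by blast

lemma sum_components: "x \<in> carrier M \<Longrightarrow> (\<Oplus>i\<in>{i. component M i x \<noteq> \<zero>}. component M i x) = x"
  using component_decomposition unfolding decomposition_def by metis

lemma component_homogeneous:
  assumes "x \<in> grade M j"
  shows "component M i x = (if i = j then x else \<zero>)"
proof (rule component_eqI[where f = "\<lambda>i. if i = j then x else \<zero>"])
  show "decomposition M x (\<lambda>i. if i = j then x else \<zero>)"
    by (subst decomposition_iff[OF abelian_monoid_axioms, where S = "{j}"])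
       (use assms grade_subset grade_closed in \<open>auto simp: finsum_singleton\<close>)
qed

lemma component_add:
  assumes x: "x \<in> carrier M" and y: "y \<in> carrier M"
  shows "component M i (x \<oplus> y) = component M i x \<oplus> component M i y"
proof (rule component_eqI[where f = "\<lambda>i. component M i x \<oplus> component M i y"])
  define S where "S = {i. component M i x \<noteq> \<zero>} \<union> {i. component M i y \<noteq> \<zero>}"
  have fin: "finite S"
    using finite_support x y unfolding S_def by simp
  have sum: "z = (\<Oplus>i\<in>S. component M i z)"
    if "z \<in> carrier M" "\<And>i. i \<notin> S \<Longrightarrow> component M i z = \<zero>" for z
    using decomposition_iff[OF abelian_monoid_axioms grade_subset fin, of "\<lambda>i. component M i z" z]
      component_decomposition that by simp
  have "x \<oplus> y = (\<Oplus>i\<in>S. component M i x) \<oplus> (\<Oplus>i\<in>S. component M i y)"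
    using sum[OF x] sum[OF y] by (simp add: S_def)
  also have "\<dots> = (\<Oplus>i\<in>S. component M i x \<oplus> component M i y)"
    by (rule finsum_addf[symmetric]) (use x y component_closed in auto)
  finally show "decomposition M (x \<oplus> y) (\<lambda>i. component M i x \<oplus> component M i y)"
    using decomposition_iff[OF abelian_monoid_axioms grade_subset fin,
        of "\<lambda>i. component M i x \<oplus> component M i y" "x \<oplus> y"] x y
    by (simp add: S_def component_grade add_grade)
qed

text \<open>
  An additive identity need only be checked on homogeneous elements. All identities about the sign
  twist, which is defined through components, are reduced to homogeneous arguments in this way.
\<close>

lemma homogeneous_induct [consumes 1, case_names homogeneous add]:
  assumes x: "x \<in> carrier M"
    and hom: "\<And>j x. x \<in> grade M j \<Longrightarrow> P x"
    and add: "\<And>x y. \<lbrakk>x \<in> carrier M; y \<in> carrier M; P x; P y\<rbrakk> \<Longrightarrow> P (x \<oplus> y)"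
  shows "P x"
proof -
  have "P (\<Oplus>i\<in>S. component M i x)" if "finite S" for S
    using that
  proof (induction S)
    case empty
    then show ?case using hom[OF zero_grade] by simp
  next
    case (insert i S)
    then show ?case
      using x add hom[OF component_grade[OF x]] component_closed by (simp add: finsum_closed)
  qed
  from this[OF finite_support[OF x]] show ?thesis
    using sum_components[OF x] by simp
qed

end

section \<open>Signs\<close>

context graded_group
begin

lemma sgn_mult_closed [simp]: "x \<in> carrier M \<Longrightarrow> sgn_mult M n x \<in> carrier M"
  by (simp add: sgn_mult_def)

lemma sgn_mult_grade: "x \<in> grade M j \<Longrightarrow> sgn_mult M n x \<in> grade M j"
  by (simp add: sgn_mult_def neg_grade)

lemma sgn_mult_zero [simp]: "sgn_mult M n \<zero> = \<zero>"
  by (simp add: sgn_mult_def)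

lemma sgn_mult_add:
  "\<lbrakk>x \<in> carrier M; y \<in> carrier M\<rbrakk> \<Longrightarrow> sgn_mult M n (x \<oplus> y) = sgn_mult M n x \<oplus> sgn_mult M n y"
  by (simp add: sgn_mult_def minus_add a_comm)

lemma sgn_mult_sgn_mult:
  "x \<in> carrier M \<Longrightarrow> sgn_mult M n (sgn_mult M m x) = sgn_mult M (n + m) x"
  by (simp add: sgn_mult_def)

text \<open>
  A common index set for the components of two elements is what shows that the twist is additive.
\<close>

lemma sgn_twist_superset:
  assumes "x \<in> carrier M" "finite S" "{j. component M j x \<noteq> \<zero>} \<subseteq> S"
  shows "sgn_twist M n x = (\<Oplus>j\<in>S. sgn_mult M (n * j) (component M j x))"
  unfolding sgn_twist_def
  by (rule add.finprod_mono_neutral_cong_left)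
     (use assms in \<open>auto simp: component_closed\<close>)

lemma sgn_twist_closed [simp]: "x \<in> carrier M \<Longrightarrow> sgn_twist M n x \<in> carrier M"
  unfolding sgn_twist_def by (auto intro!: finsum_closed simp: component_closed)

lemma sgn_twist_homogeneous:
  assumes "x \<in> grade M j"
  shows "sgn_twist M n x = sgn_mult M (n * j) x"
proof -
  have "{i. component M i x \<noteq> \<zero>} \<subseteq> {j}"
    using assms by (auto simp: component_homogeneous)
  then show ?thesis
    using sgn_twist_superset[of x "{j}" n] assms
    by (simp add: grade_closed component_homogeneous finsum_singleton)
qed

lemma sgn_twist_grade: "x \<in> grade M j \<Longrightarrow> sgn_twist M n x \<in> grade M j"
  by (simp add: sgn_twist_homogeneous sgn_mult_grade)

lemma sgn_twist_add:
  assumes x: "x \<in> carrier M" and y: "y \<in> carrier M"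
  shows "sgn_twist M n (x \<oplus> y) = sgn_twist M n x \<oplus> sgn_twist M n y"
proof -
  define S where "S = {i. component M i x \<noteq> \<zero>} \<union> {i. component M i y \<noteq> \<zero>}"
  have fin: "finite S"
    using finite_support x y unfolding S_def by simp
  have twist: "sgn_twist M n z = (\<Oplus>j\<in>S. sgn_mult M (n * j) (component M j z))"
    if "z \<in> carrier M" "{j. component M j z \<noteq> \<zero>} \<subseteq> S" for z
    by (rule sgn_twist_superset[OF that(1) fin that(2)])
  have "sgn_twist M n (x \<oplus> y) = (\<Oplus>j\<in>S. sgn_mult M (n * j) (component M j (x \<oplus> y)))"
    by (rule twist) (use x y in \<open>auto simp: S_def component_add\<close>)
  also have "\<dots> = (\<Oplus>j\<in>S. sgn_mult M (n * j) (component M j x) \<oplus> sgn_mult M (n * j) (component M j y))"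
    by (rule finsum_cong'[OF refl])
       (use x y in \<open>simp_all add: Pi_def component_add component_closed sgn_mult_add\<close>)
  also have "\<dots> = (\<Oplus>j\<in>S. sgn_mult M (n * j) (component M j x)) \<oplus> (\<Oplus>j\<in>S. sgn_mult M (n * j) (component M j y))"
    by (rule finsum_addf) (use x y component_closed in auto)
  also have "\<dots> = sgn_twist M n x \<oplus> sgn_twist M n y"
    by (subst (1 2) twist) (use x y in \<open>auto simp: S_def\<close>)
  finally show ?thesis .
qed

lemma sgn_twist_zero [simp]: "sgn_twist M n \<zero> = \<zero>"
  using sgn_twist_homogeneous[OF zero_grade] by simp

lemma sgn_twist_neg: "x \<in> carrier M \<Longrightarrow> sgn_twist M n (\<ominus> x) = \<ominus> sgn_twist M n x"
  using sgn_twist_add[of "\<ominus> x" x n] minus_equality[of "sgn_twist M n (\<ominus> x)" "sgn_twist M n x"]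
  by (simp add: l_neg)

lemma sgn_twist_sgn_mult:
  "x \<in> carrier M \<Longrightarrow> sgn_twist M n (sgn_mult M m x) = sgn_mult M m (sgn_twist M n x)"
  by (simp add: sgn_mult_def sgn_twist_neg)

lemma sgn_twist_sgn_twist:
  "x \<in> carrier M \<Longrightarrow> sgn_twist M n (sgn_twist M m x) = sgn_twist M (n + m) x"
proof (induction x rule: homogeneous_induct)
  case (homogeneous j x)
  then show ?case
    by (simp add: sgn_twist_homogeneous sgn_twist_sgn_mult grade_closed sgn_mult_sgn_mult
        distrib_right add.commute)
qed (simp add: sgn_twist_add)

lemma sgn_twist_cong:
  assumes "even n = even m"
  shows "sgn_twist M n x = sgn_twist M m x"
  using assms by (simp add: sgn_twist_def sgn_mult_def)

lemma sgn_twist_even: "\<lbrakk>even n; x \<in> carrier M\<rbrakk> \<Longrightarrow> sgn_twist M n x = x"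
  by (simp add: sgn_twist_def sgn_mult_def sum_components)

lemma sgn_twist_degree_even: "\<lbrakk>x \<in> grade M j; even j\<rbrakk> \<Longrightarrow> sgn_twist M n x = x"
  by (simp add: sgn_twist_homogeneous sgn_mult_def)

end

text \<open>
  On homogeneous elements both sides carry the sign $(-1)^{n(|a|+|b|)}$.
\<close>

lemma (in graded_ring) sgn_twist_mult:
  assumes a: "a \<in> carrier B" and b: "b \<in> carrier B"
  shows "sgn_twist B n (a \<otimes> b) = sgn_twist B n a \<otimes> sgn_twist B n b"
  using a
proof (induction a rule: homogeneous_induct)
  case a: (homogeneous i a)
  from b show ?case
  proof (induction b rule: homogeneous_induct)
    case b: (homogeneous j b)
    have "a \<in> carrier B" "b \<in> carrier B" "a \<otimes> b \<in> grade B (i + j)"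
      using a b grade_closed grade_mult by auto
    then show ?case
      using a b by (auto simp: sgn_twist_homogeneous sgn_mult_def l_minus r_minus distrib_left)
  qed (use a in \<open>simp add: grade_closed r_distr sgn_twist_add\<close>)
qed (use b in \<open>simp add: l_distr sgn_twist_add\<close>)

lemma (in graded_ring) sgn_twist_one [simp]: "sgn_twist B n \<one> = \<one>"
  using sgn_twist_degree_even[OF grade_one] by simp

context cdg_ring
begin

lemma pdiff_closed [simp]: "b \<in> carrier B \<Longrightarrow> pdiff B b \<in> carrier B"
  by (induction b rule: homogeneous_induct) (simp_all add: pdiff_add grade_closed[OF pdiff_grade])

lemma pdiff_zero [simp]: "pdiff B \<zero> = \<zero>"
  using pdiff_add[of \<zero> \<zero>] add.r_cancel_one by simp

lemma pdiff_neg: "b \<in> carrier B \<Longrightarrow> pdiff B (\<ominus> b) = \<ominus> pdiff B b"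
  using pdiff_add[of "\<ominus> b" b] minus_equality[of "pdiff B (\<ominus> b)" "pdiff B b"] by (simp add: l_neg)

lemma pdiff_sgn_twist:
  "b \<in> carrier B \<Longrightarrow> pdiff B (sgn_twist B n b) = sgn_mult B n (sgn_twist B n (pdiff B b))"
proof (induction b rule: homogeneous_induct)
  case (homogeneous j b)
  then show ?case
    using pdiff_grade[OF homogeneous] grade_closed[OF homogeneous]
    by (auto simp: sgn_twist_homogeneous sgn_mult_def pdiff_neg)
qed (simp add: sgn_twist_add pdiff_add sgn_mult_add)

end

section \<open>Arithmetic in cdg modules\<close>

context cdg_module
begin

lemma smult_zero_left [simp]: "x \<in> carrier M \<Longrightarrow> \<zero>\<^bsub>B\<^esub> \<odot> x = \<zero>"
  using smult_l_distr[of "\<zero>\<^bsub>B\<^esub>" "\<zero>\<^bsub>B\<^esub>" x] add.r_cancel_one smult_closed by simp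

lemma smult_zero_right [simp]: "b \<in> carrier B \<Longrightarrow> b \<odot> \<zero> = \<zero>"
  using smult_r_distr[of b \<zero> \<zero>] add.r_cancel_one smult_closed by simp

lemma smult_neg_left:
  assumes "b \<in> carrier B" "x \<in> carrier M"
  shows "(\<ominus>\<^bsub>B\<^esub> b) \<odot> x = \<ominus> (b \<odot> x)"
  using smult_l_distr[of "\<ominus>\<^bsub>B\<^esub> b" b x] assms
    minus_equality[of "(\<ominus>\<^bsub>B\<^esub> b) \<odot> x" "b \<odot> x"]
  by (simp add: B.l_neg smult_closed)

lemma smult_neg_right:
  assumes "b \<in> carrier B" "x \<in> carrier M"
  shows "b \<odot> (\<ominus> x) = \<ominus> (b \<odot> x)"
  using smult_r_distr[of b "\<ominus> x" x] assms minus_equality[of "b \<odot> (\<ominus> x)" "b \<odot> x"]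
  by (simp add: l_neg smult_closed)

lemma smult_sgn_mult_left:
  "\<lbrakk>b \<in> carrier B; x \<in> carrier M\<rbrakk> \<Longrightarrow> sgn_mult B n b \<odot> x = sgn_mult M n (b \<odot> x)"
  by (simp add: sgn_mult_def smult_neg_left)

lemma smult_sgn_mult_right:
  "\<lbrakk>b \<in> carrier B; x \<in> carrier M\<rbrakk> \<Longrightarrow> b \<odot> sgn_mult M n x = sgn_mult M n (b \<odot> x)"
  by (simp add: sgn_mult_def smult_neg_right)

lemma pdiff_closed [simp]: "x \<in> carrier M \<Longrightarrow> pdiff M x \<in> carrier M"
  by (induction x rule: homogeneous_induct) (simp_all add: pdiff_add grade_closed[OF pdiff_grade])

lemma pdiff_zero [simp]: "pdiff M \<zero> = \<zero>"
  using pdiff_add[of \<zero> \<zero>] add.r_cancel_one by simp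

lemma pdiff_neg: "x \<in> carrier M \<Longrightarrow> pdiff M (\<ominus> x) = \<ominus> pdiff M x"
  using pdiff_add[of "\<ominus> x" x] minus_equality[of "pdiff M (\<ominus> x)" "pdiff M x"] by (simp add: l_neg)

text \<open>
  The Leibniz rule for an arbitrary \<open>b\<close>: the twist by 1 is the additive extension of the Koszul sign.
\<close>

lemma pdiff_smult_twist:
  assumes b: "b \<in> carrier B" and x: "x \<in> carrier M"
  shows "pdiff M (b \<odot> x) = pdiff B b \<odot> x \<oplus> sgn_twist B 1 b \<odot> pdiff M x"
  using b
proof (induction b rule: B.homogeneous_induct)
  case (homogeneous j b)
  then show ?case
    using x by (simp add: pdiff_smult B.sgn_twist_homogeneous smult_sgn_mult_left B.grade_closed)
next
  case (add b b')
  then show ?case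
    using x by (simp add: smult_l_distr pdiff_add B.pdiff_add B.sgn_twist_add smult_closed a_ac)
qed

end

section \<open>Products of graded groups\<close>

lemma abelian_group_prod:
  assumes "abelian_group M" "abelian_group N"
    and carr: "carrier P = carrier M \<times> carrier N" and zero: "\<zero>\<^bsub>P\<^esub> = (\<zero>\<^bsub>M\<^esub>, \<zero>\<^bsub>N\<^esub>)"
    and add: "add P = (\<lambda>(x, y) (x', y'). (x \<oplus>\<^bsub>M\<^esub> x', y \<oplus>\<^bsub>N\<^esub> y'))"
  shows "abelian_group P"
proof -
  interpret M: abelian_group M by fact
  interpret N: abelian_group N by fact
  show ?thesis
  proof (rule abelian_groupI)
    fix x assume "x \<in> carrier P"
    then show "\<exists>y\<in>carrier P. y \<oplus>\<^bsub>P\<^esub> x = \<zero>\<^bsub>P\<^esub>"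
      by (intro bexI[where x = "(\<ominus>\<^bsub>M\<^esub> fst x, \<ominus>\<^bsub>N\<^esub> snd x)"])
         (auto simp: carr zero add M.l_neg N.l_neg)
  qed (auto simp: carr zero add M.a_ac N.a_ac)
qed

lemma a_inv_prod:
  assumes "abelian_group M" "abelian_group N"
    and carr: "carrier P = carrier M \<times> carrier N" and zero: "\<zero>\<^bsub>P\<^esub> = (\<zero>\<^bsub>M\<^esub>, \<zero>\<^bsub>N\<^esub>)"
    and add: "add P = (\<lambda>(x, y) (x', y'). (x \<oplus>\<^bsub>M\<^esub> x', y \<oplus>\<^bsub>N\<^esub> y'))"
    and "x \<in> carrier M" "y \<in> carrier N"
  shows "\<ominus>\<^bsub>P\<^esub> (x, y) = (\<ominus>\<^bsub>M\<^esub> x, \<ominus>\<^bsub>N\<^esub> y)"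
proof -
  interpret M: abelian_group M by fact
  interpret N: abelian_group N by fact
  interpret P: abelian_group P by (rule abelian_group_prod) fact+
  show ?thesis
    by (rule P.minus_equality) (use assms(6,7) in \<open>simp_all add: carr zero add M.l_neg N.l_neg\<close>)
qed

lemma finsum_prod:
  assumes "abelian_group M" "abelian_group N"
    and carr: "carrier P = carrier M \<times> carrier N" and zero: "\<zero>\<^bsub>P\<^esub> = (\<zero>\<^bsub>M\<^esub>, \<zero>\<^bsub>N\<^esub>)"
    and add: "add P = (\<lambda>(x, y) (x', y'). (x \<oplus>\<^bsub>M\<^esub> x', y \<oplus>\<^bsub>N\<^esub> y'))"
    and "finite S" "f \<in> S \<rightarrow> carrier M" "g \<in> S \<rightarrow> carrier N"
  shows "(\<Oplus>\<^bsub>P\<^esub>i\<in>S. (f i, g i)) = (\<Oplus>\<^bsub>M\<^esub>i\<in>S. f i, \<Oplus>\<^bsub>N\<^esub>i\<in>S. g i)"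
proof -
  interpret M: abelian_group M by fact
  interpret N: abelian_group N by fact
  interpret P: abelian_group P by (rule abelian_group_prod) fact+
  from assms(6,7,8) show ?thesis
  proof (induction S)
    case empty
    then show ?case by (simp add: zero)
  next
    case (insert i S)
    then have "(\<lambda>i. (f i, g i)) \<in> S \<rightarrow> carrier P" "(f i, g i) \<in> carrier P"
      by (auto simp: carr)
    with insert show ?case
      by (simp add: P.finsum_insert M.finsum_insert N.finsum_insert add)
  qed
qed

text \<open>
  A family of pairs decomposes a pair if and only if its coordinates decompose the coordinates. The
  supports of the coordinates can be smaller than the support of the family, so finite sums
  are compared over the latter.
\<close>

lemma graded_group_prod:
  fixes P (structure)
  assumes "graded_group M" "graded_group N"
    and carr: "carrier P = carrier M \<times> carrier N" and zero: "\<zero>\<^bsub>P\<^esub> = (\<zero>\<^bsub>M\<^esub>, \<zero>\<^bsub>N\<^esub>)"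
    and add: "add P = (\<lambda>(x, y) (x', y'). (x \<oplus>\<^bsub>M\<^esub> x', y \<oplus>\<^bsub>N\<^esub> y'))"
    and grade: "\<And>i. grade P i = grade M i \<times> grade N i"
  shows "graded_group P"
proof -
  interpret M: graded_group M by fact
  interpret N: graded_group N by fact
  note prod = M.abelian_group_axioms N.abelian_group_axioms carr zero add
  interpret P: abelian_group P by (rule abelian_group_prod[OF prod])
  have sub: "grade P i \<subseteq> carrier P" for i
    using M.grade_subset N.grade_subset by (auto simp: grade carr)
  have decomp: "decomposition P (x, y) f \<longleftrightarrow>
      decomposition M x (\<lambda>i. fst (f i)) \<and> decomposition N y (\<lambda>i. snd (f i))" for x y f
  proof (cases "finite {i. f i \<noteq> \<zero>}")
    case fin: True
    have supp: "fst (f i) = \<zero>\<^bsub>M\<^esub>" "snd (f i) = \<zero>\<^bsub>N\<^esub>" if "i \<notin> {i. f i \<noteq> \<zero>}" for i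
      using that by (simp_all add: zero)
    have sum: "(\<Oplus>i\<in>{i. f i \<noteq> \<zero>}. f i) =
        (\<Oplus>\<^bsub>M\<^esub>i\<in>{i. f i \<noteq> \<zero>}. fst (f i), \<Oplus>\<^bsub>N\<^esub>i\<in>{i. f i \<noteq> \<zero>}. snd (f i))"
      if "\<forall>i. f i \<in> grade P i"
    proof -
      have "f i \<in> carrier M \<times> carrier N" for i
        using that sub carr by blast
      then show ?thesis
        using finsum_prod[OF prod fin, of "\<lambda>i. fst (f i)" "\<lambda>i. snd (f i)"]
        by (simp add: Pi_def mem_Times_iff)
    qed
    moreover have "decomposition M x (\<lambda>i. fst (f i)) \<longleftrightarrow>
        (\<forall>i. fst (f i) \<in> grade M i) \<and> x = (\<Oplus>\<^bsub>M\<^esub>i\<in>{i. f i \<noteq> \<zero>}. fst (f i))"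
      by (rule decomposition_iff[OF M.abelian_monoid_axioms M.grade_subset fin supp(1)])
    moreover have "decomposition N y (\<lambda>i. snd (f i)) \<longleftrightarrow>
        (\<forall>i. snd (f i) \<in> grade N i) \<and> y = (\<Oplus>\<^bsub>N\<^esub>i\<in>{i. f i \<noteq> \<zero>}. snd (f i))"
      by (rule decomposition_iff[OF N.abelian_monoid_axioms N.grade_subset fin supp(2)])
    ultimately show ?thesis
      using fin by (auto simp: decomposition_def[of P] grade mem_Times_iff)
  next
    case False
    have "{i. f i \<noteq> \<zero>} \<subseteq> {i. fst (f i) \<noteq> \<zero>\<^bsub>M\<^esub>} \<union> {i. snd (f i) \<noteq> \<zero>\<^bsub>N\<^esub>}"
      by (auto simp: zero prod_eq_iff)
    then have "infinite {i. fst (f i) \<noteq> \<zero>\<^bsub>M\<^esub>} \<or> infinite {i. snd (f i) \<noteq> \<zero>\<^bsub>N\<^esub>}"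
      using False finite_subset by blast
    then show ?thesis
      using False by (auto simp: decomposition_def)
  qed
  show ?thesis
  proof (intro graded_group.intro graded_group_axioms.intro)
    show "abelian_group P" by (rule P.abelian_group_axioms)
  next
    fix i
    have "subgroup (grade P i) (add_monoid P)"
    proof (rule P.add.subgroupI)
      show "grade P i \<subseteq> carrier P"
        by (rule sub)
      show "grade P i \<noteq> {}"
        using M.zero_grade[of i] N.zero_grade[of i] by (auto simp: grade simp del: M.zero_grade N.zero_grade)
    next
      fix x assume "x \<in> grade P i"
      then show "\<ominus> x \<in> grade P i"
        by (auto simp: grade a_inv_prod[OF prod] M.neg_grade N.neg_grade
            M.grade_closed N.grade_closed)
    next
      fix x y assume "x \<in> grade P i" "y \<in> grade P i"
      then show "x \<oplus> y \<in> grade P i"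
        by (auto simp: grade add M.add_grade N.add_grade)
    qed
    then show "additive_subgroup (grade P i) P"
      by (rule additive_subgroupI)
  next
    fix z assume "z \<in> carrier P"
    then obtain x y where z: "z = (x, y)" and x: "x \<in> carrier M" and y: "y \<in> carrier N"
      by (auto simp: carr)
    obtain f where f: "decomposition M x f" "\<And>f'. decomposition M x f' \<Longrightarrow> f' = f"
      using M.decomposition_ex1[OF x] by blast
    obtain g where g: "decomposition N y g" "\<And>g'. decomposition N y g' \<Longrightarrow> g' = g"
      using N.decomposition_ex1[OF y] by blast
    show "\<exists>!h. decomposition P z h"
    proof (rule ex1I[where a = "\<lambda>i. (f i, g i)"])
      show "decomposition P z (\<lambda>i. (f i, g i))"
        using f(1) g(1) by (simp add: z decomp)
      fix h assume "decomposition P z h"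
      then have "(\<lambda>i. fst (h i)) = f" "(\<lambda>i. snd (h i)) = g"
        using f(2) g(2) by (simp_all add: z decomp)
      then show "h = (\<lambda>i. (f i, g i))"
        by (auto simp: fun_eq_iff prod_eq_iff)
    qed
  qed
qed

section \<open>Restriction of scalars and the curved dual numbers\<close>

text \<open>
  Restriction of scalars changes the type of the record and its scalar action; being a graded group
  depends on neither.
\<close>

lemma graded_group_cong:
  fixes M :: "('r, 'm, 'z) pdg_module_scheme" and P :: "('s, 'm, 'y) pdg_module_scheme"
  assumes "graded_group M" and carr: "carrier P = carrier M" and zero: "\<zero>\<^bsub>P\<^esub> = \<zero>\<^bsub>M\<^esub>"
    and add: "add P = add M" and grade: "grade P = grade M"
  shows "graded_group P"
proof -
  interpret M: graded_group M by fact
  have "abelian_group P"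
    by (rule abelian_groupI)
       (auto simp: carr zero add M.a_ac intro!: bexI[where x = "\<ominus>\<^bsub>M\<^esub> x" for x] M.l_neg)
  moreover have "additive_subgroup (grade P i) P" for i
    using M.grade_subgroup[of i]
    by (simp add: additive_subgroup_def subgroup_def m_inv_def carr zero add grade)
  moreover have "decomposition P = decomposition M"
    by (simp add: fun_eq_iff decomposition_def finsum_def finprod_def carr zero add grade)
  ultimately show ?thesis
    using M.decomposition_ex1 by (simp add: graded_group_def graded_group_axioms_def carr)
qed

lemma cdg_module_restrict_scalars:
  fixes N :: "('c, 'm) pdg_module"
  assumes "cdg_ring B" "cdg_module C N"
    and closed: "\<And>b. b \<in> carrier B \<Longrightarrow> f b \<in> carrier C"
    and add: "\<And>a b. \<lbrakk>a \<in> carrier B; b \<in> carrier B\<rbrakk> \<Longrightarrow> f (a \<oplus>\<^bsub>B\<^esub> b) = f a \<oplus>\<^bsub>C\<^esub> f b"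
    and mult: "\<And>a b. \<lbrakk>a \<in> carrier B; b \<in> carrier B\<rbrakk> \<Longrightarrow> f (a \<otimes>\<^bsub>B\<^esub> b) = f a \<otimes>\<^bsub>C\<^esub> f b"
    and one: "f \<one>\<^bsub>B\<^esub> = \<one>\<^bsub>C\<^esub>"
    and grade: "\<And>b i. b \<in> grade B i \<Longrightarrow> f b \<in> grade C i"
    and pdiff: "\<And>b. b \<in> carrier B \<Longrightarrow> f (pdiff B b) = pdiff C (f b)"
    and curv: "f (curv B) = curv C"
  shows "cdg_module B (restrict_scalars f N)"
proof -
  interpret B: cdg_ring B by fact
  interpret N: cdg_module C N by fact
  have simps: "carrier (restrict_scalars f N) = carrier N" "zero (restrict_scalars f N) = zero N"
    "Ring.add (restrict_scalars f N) = Ring.add N" "smult (restrict_scalars f N) = (\<lambda>b x. f b \<odot>\<^bsub>N\<^esub> x)"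
    "Defs.grade (restrict_scalars f N) = Defs.grade N" "Defs.pdiff (restrict_scalars f N) = Defs.pdiff N"
    by (simp_all add: restrict_scalars_def)
  have sgn: "sgn_mult (restrict_scalars f N) i x = sgn_mult N i x" for i x
    by (simp add: sgn_mult_def a_inv_def m_inv_def simps)
  have "graded_group (restrict_scalars f N)"
    by (rule graded_group_cong[OF N.graded_group_axioms]) (simp_all add: simps)
  then show ?thesis
    by (intro cdg_module.intro cdg_module_axioms.intro B.cdg_ring_axioms)
       (auto simp: simps sgn closed add mult one grade pdiff curv B.grade_closed
          N.smult_closed N.smult_l_distr N.smult_r_distr N.smult_assoc N.smult_one N.smult_grade
          N.pdiff_add N.pdiff_grade N.pdiff_smult N.pdiff_pdiff)
qed

lemma curved_dual_simps:
  "carrier (curved_dual A \<phi>) = carrier A \<times> carrier A"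
  "\<zero>\<^bsub>curved_dual A \<phi>\<^esub> = (\<zero>\<^bsub>A\<^esub>, \<zero>\<^bsub>A\<^esub>)"
  "\<one>\<^bsub>curved_dual A \<phi>\<^esub> = (\<one>\<^bsub>A\<^esub>, \<zero>\<^bsub>A\<^esub>)"
  "add (curved_dual A \<phi>) = (\<lambda>(a, a') (b, b'). (a \<oplus>\<^bsub>A\<^esub> b, a' \<oplus>\<^bsub>A\<^esub> b'))"
  "(a, a') \<otimes>\<^bsub>curved_dual A \<phi>\<^esub> (b, b') = (a \<otimes>\<^bsub>A\<^esub> b, a \<otimes>\<^bsub>A\<^esub> b' \<oplus>\<^bsub>A\<^esub> a' \<otimes>\<^bsub>A\<^esub> b)"
  "grade (curved_dual A \<phi>) i = grade A i \<times> grade A i"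
  "pdiff (curved_dual A \<phi>) (a, a') = (pdiff A a, pdiff A a')"
  "curv (curved_dual A \<phi>) = (\<zero>\<^bsub>A\<^esub>, \<phi>)"
  by (simp_all add: curved_dual_def dual_numbers_def)

text \<open>
  The square of the predifferential is zero, so the curvature $\phi\epsilon$ has to be central; this
  is where centrality of \<open>\<phi>\<close> enters.
\<close>

lemma cdg_ring_curved_dual:
  fixes A :: "('k, 'a) cdg_algebra" (structure)
  assumes "cdg_ring A" and curv: "curv A = \<zero>"
    and phi: "\<phi> \<in> grade A 2" and central: "\<And>a. a \<in> carrier A \<Longrightarrow> \<phi> \<otimes> a = a \<otimes> \<phi>"
    and pdiff_phi: "pdiff A \<phi> = \<zero>"
  shows "cdg_ring (curved_dual A \<phi>)" (is "cdg_ring ?D")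
proof -
  interpret A: cdg_ring A by fact
  note [simp] = curved_dual_simps
  have phi_closed: "\<phi> \<in> carrier A"
    using phi A.grade_closed by blast
  have graded: "graded_group ?D"
    by (rule graded_group_prod[OF A.graded_group_axioms A.graded_group_axioms]) simp_all
  have neg: "\<ominus>\<^bsub>?D\<^esub> (a, b) = (\<ominus> a, \<ominus> b)" if "a \<in> carrier A" "b \<in> carrier A" for a b
    by (rule a_inv_prod[OF A.abelian_group_axioms A.abelian_group_axioms]) (simp_all add: that)
  have ring: "ring ?D"
  proof (rule ringI)
    show "abelian_group ?D"
      using graded by (simp add: graded_group_def)
    show "monoid ?D"
      by (rule monoidI) (auto simp: A.m_assoc A.l_distr A.r_distr A.a_ac)
  qed (auto simp: A.l_distr A.r_distr A.a_ac)
  have leibniz: "pdiff ?D (a \<otimes>\<^bsub>?D\<^esub> b) = pdiff ?D a \<otimes>\<^bsub>?D\<^esub> b \<oplus>\<^bsub>?D\<^esub> sgn_mult ?D i (a \<otimes>\<^bsub>?D\<^esub> pdiff ?D b)"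
    if "a \<in> grade ?D i" "b \<in> carrier ?D" for a b i
  proof -
    obtain a1 a2 b1 b2 where ab: "a = (a1, a2)" "b = (b1, b2)"
      by (metis surj_pair)
    have "a1 \<in> grade A i" "a2 \<in> grade A i" and b: "b1 \<in> carrier A" "b2 \<in> carrier A"
      using that by (auto simp: ab)
    moreover from this have "a1 \<in> carrier A" "a2 \<in> carrier A"
      using A.grade_closed by auto
    ultimately show ?thesis
      by (simp add: ab A.pdiff_add A.pdiff_mult sgn_mult_def neg A.minus_add A.a_ac)
  qed
  have square: "pdiff A (pdiff A a) = \<zero>" if "a \<in> carrier A" for a
    using A.pdiff_pdiff[OF that] that by (simp add: curv a_minus_def)
  show ?thesis
  proof (intro cdg_ring.intro graded_ring.intro ring graded cdg_ring_axioms.intro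
      graded_ring_axioms.intro leibniz)
    show "pdiff ?D (pdiff ?D b) = curv ?D \<otimes>\<^bsub>?D\<^esub> b \<ominus>\<^bsub>?D\<^esub> b \<otimes>\<^bsub>?D\<^esub> curv ?D"
      if "b \<in> carrier ?D" for b
      using that by (auto simp: square a_minus_def neg phi_closed central A.r_neg)
  qed (auto simp: A.grade_one A.grade_mult A.add_grade A.pdiff_add A.pdiff_grade phi pdiff_phi)
qed

section \<open>Graded maps out of a shifted splitting module\<close>

lemma shift_splitting_simps:
  "carrier (shift B i (splitting_module B \<phi> \<psi>)) = carrier B \<times> carrier B"
  "add (shift B i (splitting_module B \<phi> \<psi>)) = (\<lambda>(a, b) (a', b'). (a \<oplus>\<^bsub>B\<^esub> a', b \<oplus>\<^bsub>B\<^esub> b'))"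
  "c \<odot>\<^bsub>shift B i (splitting_module B \<phi> \<psi>)\<^esub> (a, b) =
     (sgn_twist B i c \<otimes>\<^bsub>B\<^esub> a, sgn_twist B (- 1) (sgn_twist B i c) \<otimes>\<^bsub>B\<^esub> b)"
  "grade (shift B i (splitting_module B \<phi> \<psi>)) j = grade B (i + j) \<times> grade B (i + j - 1)"
  by (simp_all add: shift_def splitting_module_def direct_sum_def regular_module_def algebra_simps)

text \<open>
  The sign of the shift is taken in the pair module, so its negation must be identified first.
\<close>

lemma (in cdg_ring) pdiff_shift_splitting:
  assumes "\<phi> \<in> carrier B" "\<psi> \<in> carrier B" "a \<in> carrier B" "b \<in> carrier B"
  shows "pdiff (shift B i (splitting_module B \<phi> \<psi>)) (a, b) =
    (sgn_mult B i (pdiff B a \<oplus> b \<otimes> \<phi>), sgn_mult B i (\<ominus> pdiff B b \<oplus> a \<otimes> \<psi>))"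
proof -
  have "\<ominus>\<^bsub>splitting_module B \<phi> \<psi>\<^esub> (x, y) = (\<ominus> x, \<ominus> y)" if "x \<in> carrier B" "y \<in> carrier B" for x y
    by (rule a_inv_prod[OF abelian_group_axioms abelian_group_axioms])
       (simp_all add: that splitting_module_def direct_sum_def regular_module_def shift_def)
  then show ?thesis
    using assms by (simp add: shift_def sgn_mult_def splitting_module_def)
qed

text \<open>
  The graded linear map with value \<open>u\<close> on \<open>(1, 0)\<close> and \<open>v\<close> on \<open>(0, 1)\<close>. On $B_{\phi,\psi}[i]$ an
  element \<open>(b, 0)\<close> is $(-1)^{i|b|} b \cdot (1, 0)$, and a map of degree \<open>k\<close> contributes another sign
  $(-1)^{k|b|}$ by linearity; so \<open>n = i + k\<close>, with one more sign for the summand $B[-1]$.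
\<close>

definition free_map :: "('k, 'b, 'z) pdg_module_scheme \<Rightarrow> ('b, 'm) pdg_module \<Rightarrow> int \<Rightarrow>
    'm \<Rightarrow> 'm \<Rightarrow> 'b \<times> 'b \<Rightarrow> 'm" where
  "free_map B N n u v = (\<lambda>(a, b)\<in>carrier B \<times> carrier B.
     sgn_twist B n a \<odot>\<^bsub>N\<^esub> u \<oplus>\<^bsub>N\<^esub> sgn_twist B (n + 1) b \<odot>\<^bsub>N\<^esub> v)"

locale splitting_target = cdg_module B N for B and N :: "('b, 'm) pdg_module" (structure) +
  fixes \<phi> \<psi> :: 'b
  assumes phi_grade: "\<phi> \<in> grade B 2"
    and psi_grade: "\<psi> \<in> grade B 0"
begin

abbreviation S :: "int \<Rightarrow> ('b, 'b \<times> 'b) pdg_module" where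
  "S i \<equiv> shift B i (splitting_module B \<phi> \<psi>)"

lemma phi_closed [simp]: "\<phi> \<in> carrier B"
  using phi_grade B.grade_closed by blast

lemma psi_closed [simp]: "\<psi> \<in> carrier B"
  using psi_grade B.grade_closed by blast

lemma free_map_apply:
  "\<lbrakk>a \<in> carrier B; b \<in> carrier B\<rbrakk> \<Longrightarrow>
    free_map B N n u v (a, b) = sgn_twist B n a \<odot> u \<oplus> sgn_twist B (n + 1) b \<odot> v"
  by (simp add: free_map_def)

lemma free_map_generators:
  assumes "u \<in> carrier N" "v \<in> carrier N"
  shows "free_map B N n u v (\<one>\<^bsub>B\<^esub>, \<zero>\<^bsub>B\<^esub>) = u" "free_map B N n u v (\<zero>\<^bsub>B\<^esub>, \<one>\<^bsub>B\<^esub>) = v"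
  using assms by (simp_all add: free_map_apply smult_one)

lemma free_map_in_graded_hom:
  assumes u: "u \<in> grade N (k - i)" and v: "v \<in> grade N (k - i + 1)"
  shows "free_map B N (i + k) u v \<in> graded_hom B k (S i) N"
  unfolding graded_hom_def mem_Collect_eq
proof (intro conjI ballI allI)
  have [simp]: "u \<in> carrier N" "v \<in> carrier N"
    using u v grade_closed by auto
  show "free_map B N (i + k) u v \<in> carrier (S i) \<rightarrow>\<^sub>E carrier N"
    by (auto simp: shift_splitting_simps free_map_def smult_closed)
  fix z w assume "z \<in> carrier (S i)" "w \<in> carrier (S i)"
  then show "free_map B N (i + k) u v (z \<oplus>\<^bsub>S i\<^esub> w) =
      free_map B N (i + k) u v z \<oplus> free_map B N (i + k) u v w"
    by (auto simp: shift_splitting_simps free_map_apply B.sgn_twist_add smult_l_distr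
        smult_closed a_ac)
next
  fix j z assume "z \<in> grade (S i) j"
  then obtain a b where z: "z = (a, b)" and a: "a \<in> grade B (i + j)" and b: "b \<in> grade B (i + j - 1)"
    by (auto simp: shift_splitting_simps)
  have "sgn_twist B (i + k) a \<odot> u \<in> grade N (j + k)"
    using smult_grade[OF B.sgn_twist_grade[OF a] u] by (simp add: algebra_simps)
  moreover have "sgn_twist B (i + k + 1) b \<odot> v \<in> grade N (j + k)"
    using smult_grade[OF B.sgn_twist_grade[OF b] v] by (simp add: algebra_simps)
  ultimately show "free_map B N (i + k) u v z \<in> grade N (j + k)"
    using a b by (simp add: z free_map_apply B.grade_closed add_grade)
next
  have [simp]: "u \<in> carrier N" "v \<in> carrier N"
    using u v grade_closed by auto
  fix j c z assume c: "c \<in> grade B j" and "z \<in> carrier (S i)"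
  then obtain a b where z: "z = (a, b)" and ab [simp]: "a \<in> carrier B" "b \<in> carrier B"
    by (auto simp: shift_splitting_simps)
  have [simp]: "c \<in> carrier B"
    using c B.grade_closed by blast
  have twist: "sgn_twist B n c = sgn_mult B (k * j) c" if "even n = even k" for n
    using that by (simp add: B.sgn_twist_homogeneous[OF c] sgn_mult_def)
  show "free_map B N (i + k) u v (c \<odot>\<^bsub>S i\<^esub> z) = sgn_mult N (k * j) (c \<odot> free_map B N (i + k) u v z)"
    by (simp add: z shift_splitting_simps free_map_apply B.sgn_twist_mult B.sgn_twist_sgn_twist
        twist smult_assoc smult_closed smult_sgn_mult_left smult_r_distr sgn_mult_add)
qed

text \<open>
  Linearity is assumed for homogeneous scalars only, so each coordinate is treated by induction over
  sums of homogeneous elements.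
\<close>

lemma graded_hom_eq_free_map:
  assumes f: "f \<in> graded_hom B k (S i) N"
  shows "f = free_map B N (i + k) (f (\<one>\<^bsub>B\<^esub>, \<zero>\<^bsub>B\<^esub>)) (f (\<zero>\<^bsub>B\<^esub>, \<one>\<^bsub>B\<^esub>))" (is "f = free_map B N _ ?u ?v")
proof
  have PiE: "f \<in> carrier B \<times> carrier B \<rightarrow>\<^sub>E carrier N"
    using f by (simp only: graded_hom_def mem_Collect_eq shift_splitting_simps)
  have additive: "f (z \<oplus>\<^bsub>S i\<^esub> w) = f z \<oplus> f w" if "z \<in> carrier (S i)" "w \<in> carrier (S i)" for z w
    using f that unfolding graded_hom_def by blast
  have linear: "f (c \<odot>\<^bsub>S i\<^esub> z) = sgn_mult N (k * j) (c \<odot> f z)"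
    if "c \<in> grade B j" "z \<in> carrier (S i)" for c j z
    using f that unfolding graded_hom_def by blast
  have f_closed [simp]: "f (a, b) \<in> carrier N" if "a \<in> carrier B" "b \<in> carrier B" for a b
    using PiE that by blast
  have f_undef: "f z = undefined" if "z \<notin> carrier B \<times> carrier B" for z
    using PiE that by (rule PiE_arb)
  have f_add: "f (a \<oplus>\<^bsub>B\<^esub> a', b \<oplus>\<^bsub>B\<^esub> b') = f (a, b) \<oplus> f (a', b')"
    if "a \<in> carrier B" "b \<in> carrier B" "a' \<in> carrier B" "b' \<in> carrier B" for a b a' b'
    using additive[of "(a, b)" "(a', b')"] that by (simp add: shift_splitting_simps)
  have f_smult: "f (sgn_twist B i c \<otimes>\<^bsub>B\<^esub> a, sgn_twist B (i - 1) c \<otimes>\<^bsub>B\<^esub> b) =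
      sgn_mult N (k * j) (c \<odot> f (a, b))"
    if c: "c \<in> grade B j" and ab: "a \<in> carrier B" "b \<in> carrier B" for c j a b
    using linear[OF c, of "(a, b)"] ab B.grade_closed[OF c]
    by (simp add: shift_splitting_simps B.sgn_twist_sgn_twist)
  have left: "f (a, \<zero>\<^bsub>B\<^esub>) = sgn_twist B (i + k) a \<odot> ?u" if "a \<in> carrier B" for a
    using that
  proof (induction a rule: B.homogeneous_induct)
    case (homogeneous j a)
    have "f (a, \<zero>\<^bsub>B\<^esub>) = sgn_mult N (k * j) (sgn_twist B i a \<odot> ?u)"
      using f_smult[OF B.sgn_twist_grade[OF homogeneous, of i], of "\<one>\<^bsub>B\<^esub>" "\<zero>\<^bsub>B\<^esub>"]
        B.grade_closed[OF homogeneous]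
      by (simp add: B.sgn_twist_sgn_twist B.sgn_twist_even)
    then show ?case
      using B.grade_closed[OF homogeneous]
      by (simp add: B.sgn_twist_homogeneous[OF homogeneous] smult_sgn_mult_left sgn_mult_sgn_mult
          smult_closed algebra_simps)
  next
    case (add a a')
    then show ?case
      using f_add[of a "\<zero>\<^bsub>B\<^esub>" a' "\<zero>\<^bsub>B\<^esub>"] by (simp add: B.sgn_twist_add smult_l_distr)
  qed
  have right: "f (\<zero>\<^bsub>B\<^esub>, b) = sgn_twist B (i + k + 1) b \<odot> ?v" if "b \<in> carrier B" for b
    using that
  proof (induction b rule: B.homogeneous_induct)
    case (homogeneous j b)
    have "f (\<zero>\<^bsub>B\<^esub>, b) = sgn_mult N (k * j) (sgn_twist B (i - 1) b \<odot> ?v)"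
      using f_smult[OF B.sgn_twist_grade[OF homogeneous, of "i - 1"], of "\<zero>\<^bsub>B\<^esub>" "\<one>\<^bsub>B\<^esub>"]
        B.grade_closed[OF homogeneous]
      by (simp add: B.sgn_twist_sgn_twist B.sgn_twist_even)
    also have "sgn_twist B (i - 1) b = sgn_twist B (i + 1) b"
      by (rule B.sgn_twist_cong) simp
    finally show ?case
      using B.grade_closed[OF homogeneous]
      by (simp add: B.sgn_twist_homogeneous[OF homogeneous] smult_sgn_mult_left sgn_mult_sgn_mult
          smult_closed algebra_simps)
  next
    case (add b b')
    then show ?case
      using f_add[of "\<zero>\<^bsub>B\<^esub>" b "\<zero>\<^bsub>B\<^esub>" b'] by (simp add: B.sgn_twist_add smult_l_distr)
  qed
  fix z :: "'b \<times> 'b"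
  show "f z = free_map B N (i + k) ?u ?v z"
  proof (cases "z \<in> carrier B \<times> carrier B")
    case True
    then obtain a b where z: "z = (a, b)" "a \<in> carrier B" "b \<in> carrier B"
      by blast
    have "f z = f (a, \<zero>\<^bsub>B\<^esub>) \<oplus> f (\<zero>\<^bsub>B\<^esub>, b)"
      using f_add[of a "\<zero>\<^bsub>B\<^esub>" "\<zero>\<^bsub>B\<^esub>" b] z by simp
    also have "\<dots> = free_map B N (i + k) ?u ?v z"
      unfolding left[OF z(2)] right[OF z(3)] using z by (simp add: free_map_apply)
    finally show ?thesis .
  next
    case False
    then show ?thesis
      by (simp add: f_undef free_map_def restrict_def)
  qed
qed

lemma graded_hom_splitting_module:
  "graded_hom B k (S i) N =
    {free_map B N (i + k) u v | u v. u \<in> grade N (k - i) \<and> v \<in> grade N (k - i + 1)}"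
proof (intro equalityI subsetI)
  fix f assume f: "f \<in> graded_hom B k (S i) N"
  have "(\<one>\<^bsub>B\<^esub>, \<zero>\<^bsub>B\<^esub>) \<in> grade (S i) (- i)" "(\<zero>\<^bsub>B\<^esub>, \<one>\<^bsub>B\<^esub>) \<in> grade (S i) (1 - i)"
    by (simp_all add: shift_splitting_simps B.grade_one)
  then have "f (\<one>\<^bsub>B\<^esub>, \<zero>\<^bsub>B\<^esub>) \<in> grade N (- i + k)" "f (\<zero>\<^bsub>B\<^esub>, \<one>\<^bsub>B\<^esub>) \<in> grade N (1 - i + k)"
    using f unfolding graded_hom_def by blast+
  then show "f \<in> {free_map B N (i + k) u v | u v. u \<in> grade N (k - i) \<and> v \<in> grade N (k - i + 1)}"
    using graded_hom_eq_free_map[OF f] by (auto simp: algebra_simps)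
qed (auto simp: free_map_in_graded_hom)

end

section \<open>Morphisms and homotopies out of a shifted splitting module\<close>

lemma sep_Collect2: "{f \<in> {F x y | x y. P x y}. Q f} = {F x y | x y. P x y \<and> Q (F x y)}"
  by blast

lemma image_Collect2: "T ` {F x y | x y. P x y} = {T (F x y) | x y. P x y}"
  by blast

lemma Collect2_cong:
  assumes "\<And>x y. P x y \<longleftrightarrow> Q x y" "\<And>x y. P x y \<Longrightarrow> F x y = G x y"
  shows "{F x y | x y. P x y} = {G x y | x y. Q x y}"
  using assms by (metis (mono_tags, lifting))

context splitting_target
begin

text \<open>
  The commutator of the predifferential with the map given by \<open>(u, v)\<close> is again a graded linear map,
  of one degree more, so it is determined by its values on the two generators. These are computed
  from $d(e_0) = \pm\psi e_1$ and $d(e_1) = \pm\phi e_0$. With \<open>n = i\<close> the sign of the first summand is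
  \<open>+\<close> and this computes the failure to commute with predifferentials; with \<open>n = i - 1\<close> it is \<open>-\<close> and
  this computes the boundary $dh + hd$ of a homotopy. The argument \<open>z\<close> is not homogeneous, which
  is why the Leibniz rule is used here in its sign twist form.
\<close>

lemma pdiff_free_map:
  assumes u [simp]: "u \<in> carrier N" and v [simp]: "v \<in> carrier N"
    and z: "z \<in> carrier B \<times> carrier B"
  shows "pdiff N (free_map B N n u v z) =
    sgn_mult N (n + i) (free_map B N n u v (pdiff (S i) z)) \<oplus>
    free_map B N (n + 1) (pdiff N u \<ominus> sgn_mult N n (\<psi> \<odot> v)) (pdiff N v \<ominus> sgn_mult N n (\<phi> \<odot> u)) z"
proof -
  obtain a b where z: "z = (a, b)" and a [simp]: "a \<in> carrier B" and b [simp]: "b \<in> carrier B"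
    using z by blast
  have twist2: "sgn_twist B (2 + n) c = sgn_twist B n c" "sgn_twist B (n + 2) c = sgn_twist B n c" for c
    by (rule B.sgn_twist_cong, simp)+
  have phi [simp]: "sgn_twist B m \<phi> = \<phi>" for m
    using B.sgn_twist_degree_even[OF phi_grade] by simp
  have psi [simp]: "sgn_twist B m \<psi> = \<psi>" for m
    using B.sgn_twist_degree_even[OF psi_grade] by simp
  \<comment> \<open>All terms are of six kinds. The terms \<open>U\<close> and \<open>V\<close>, in which \<open>\<phi>\<close> and \<open>\<psi>\<close> act, occur in both
    summands on the right with opposite signs; the other four are the left-hand side.\<close>
  define P where "P = sgn_twist B n (pdiff B a) \<odot> u"
  define Q where "Q = sgn_twist B (n + 1) a \<odot> pdiff N u"
  define R where "R = sgn_twist B (n + 1) (pdiff B b) \<odot> v"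
  define T where "T = sgn_twist B n b \<odot> pdiff N v"
  define U where "U = sgn_mult N n (sgn_twist B n b \<odot> (\<phi> \<odot> u))"
  define V where "V = sgn_mult N n (sgn_twist B (n + 1) a \<odot> (\<psi> \<odot> v))"
  have [simp]: "P \<in> carrier N" "Q \<in> carrier N" "R \<in> carrier N" "T \<in> carrier N" "U \<in> carrier N"
    "V \<in> carrier N"
    by (simp_all add: P_def Q_def R_def T_def U_def V_def smult_closed)
  have "pdiff N (free_map B N n u v z) = (sgn_mult N n P \<oplus> Q) \<oplus> (\<ominus> sgn_mult N n R \<oplus> T)"
    by (simp add: z free_map_apply pdiff_add pdiff_smult_twist smult_closed B.pdiff_sgn_twist
        B.sgn_twist_sgn_twist twist2 smult_sgn_mult_left P_def Q_def R_def T_def add.commute[of 1 n])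
       (simp add: sgn_mult_def smult_closed)
  moreover have "sgn_mult N (n + i) (free_map B N n u v (pdiff (S i) z)) =
      (sgn_mult N n P \<oplus> U) \<oplus> (\<ominus> sgn_mult N n R \<oplus> V)"
  proof -
    have "free_map B N n u v (pdiff (S i) z) =
        sgn_mult N i (P \<oplus> sgn_mult N n U) \<oplus> sgn_mult N i (\<ominus> R \<oplus> sgn_mult N n V)"
      by (simp add: z B.pdiff_shift_splitting free_map_apply B.sgn_twist_sgn_mult B.sgn_twist_add
          B.sgn_twist_neg B.sgn_twist_mult smult_sgn_mult_left smult_l_distr smult_assoc
          smult_neg_left smult_closed sgn_mult_sgn_mult P_def R_def U_def V_def)
         (simp add: sgn_mult_def)
    then show ?thesis
      by (simp add: sgn_mult_add sgn_mult_sgn_mult) (auto simp: sgn_mult_def)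
  qed
  moreover have "free_map B N (n + 1) (pdiff N u \<ominus> sgn_mult N n (\<psi> \<odot> v))
      (pdiff N v \<ominus> sgn_mult N n (\<phi> \<odot> u)) z = (Q \<oplus> \<ominus> V) \<oplus> (T \<oplus> \<ominus> U)"
    by (simp add: z free_map_apply twist2 a_minus_def smult_r_distr smult_neg_right smult_closed
        smult_sgn_mult_right Q_def T_def U_def V_def)
  moreover have "((sgn_mult N n P \<oplus> U) \<oplus> (\<ominus> sgn_mult N n R \<oplus> V)) \<oplus> ((Q \<oplus> \<ominus> V) \<oplus> (T \<oplus> \<ominus> U)) =
      ((sgn_mult N n P \<oplus> Q) \<oplus> (\<ominus> sgn_mult N n R \<oplus> T)) \<oplus> ((U \<oplus> \<ominus> U) \<oplus> (V \<oplus> \<ominus> V))"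
    by (simp add: a_ac)
  ultimately show ?thesis
    by (simp add: r_neg)
qed

lemma free_map_closed [simp]:
  "\<lbrakk>u \<in> carrier N; v \<in> carrier N; z \<in> carrier B \<times> carrier B\<rbrakk> \<Longrightarrow> free_map B N n u v z \<in> carrier N"
  by (auto simp: free_map_apply smult_closed)

lemma pdiff_shift_splitting_closed:
  "z \<in> carrier B \<times> carrier B \<Longrightarrow> pdiff (S i) z \<in> carrier B \<times> carrier B"
  by (auto simp: B.pdiff_shift_splitting)

text \<open>
  A graded map commutes with the predifferentials when the commutator vanishes, and the commutator
  vanishes when its values on the two generators do.
\<close>

lemma carrier_cdg_hom_splitting_module:
  "carrier (cdg_hom B (S i) N) = {free_map B N i x y | x y. x \<in> grade N (- i) \<and> y \<in> grade N (1 - i) \<and>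
     pdiff N x = sgn_mult N i (\<psi> \<odot> y) \<and> pdiff N y = sgn_mult N i (\<phi> \<odot> x)}"
proof -
  have "(\<forall>z\<in>carrier (S i). free_map B N i x y (pdiff (S i) z) = pdiff N (free_map B N i x y z)) \<longleftrightarrow>
      pdiff N x = sgn_mult N i (\<psi> \<odot> y) \<and> pdiff N y = sgn_mult N i (\<phi> \<odot> x)" (is "?L \<longleftrightarrow> ?R")
    if "x \<in> grade N (- i)" "y \<in> grade N (1 - i)" for x y
  proof -
    have [simp]: "x \<in> carrier N" "y \<in> carrier N"
      using that grade_closed by auto
    let ?p = "pdiff N x \<ominus> sgn_mult N i (\<psi> \<odot> y)" and ?q = "pdiff N y \<ominus> sgn_mult N i (\<phi> \<odot> x)"
    have pq: "?p \<in> carrier N" "?q \<in> carrier N"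
      by (simp_all add: smult_closed)
    have commutes_iff: "free_map B N i x y (pdiff (S i) z) = pdiff N (free_map B N i x y z) \<longleftrightarrow>
        free_map B N (i + 1) ?p ?q z = \<zero>" if z: "z \<in> carrier B \<times> carrier B" for z
    proof -
      have "pdiff N (free_map B N i x y z) =
          free_map B N i x y (pdiff (S i) z) \<oplus> free_map B N (i + 1) ?p ?q z"
        using pdiff_free_map[of x y z i i] z by (simp add: sgn_mult_def)
      moreover have "free_map B N i x y (pdiff (S i) z) \<in> carrier N"
        using pdiff_shift_splitting_closed[OF z] by simp
      moreover have "free_map B N (i + 1) ?p ?q z \<in> carrier N"
        using pq z by simp
      ultimately show ?thesis
        by (simp add: add.r_cancel_one')
    qed
    have "?L \<longleftrightarrow> (\<forall>z\<in>carrier B \<times> carrier B. free_map B N (i + 1) ?p ?q z = \<zero>)"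
      using commutes_iff by (simp add: shift_splitting_simps)
    also have "\<dots> \<longleftrightarrow> ?p = \<zero> \<and> ?q = \<zero>"
    proof
      assume *: "\<forall>z\<in>carrier B \<times> carrier B. free_map B N (i + 1) ?p ?q z = \<zero>"
      have "free_map B N (i + 1) ?p ?q (\<one>\<^bsub>B\<^esub>, \<zero>\<^bsub>B\<^esub>) = \<zero>" "free_map B N (i + 1) ?p ?q (\<zero>\<^bsub>B\<^esub>, \<one>\<^bsub>B\<^esub>) = \<zero>"
        by (rule *[rule_format], simp)+
      then show "?p = \<zero> \<and> ?q = \<zero>"
        unfolding free_map_generators[OF pq] by blast
    next
      assume "?p = \<zero> \<and> ?q = \<zero>"
      then show "\<forall>z\<in>carrier B \<times> carrier B. free_map B N (i + 1) ?p ?q z = \<zero>"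
        by (auto simp: free_map_apply)
    qed
    also have "\<dots> \<longleftrightarrow> ?R"
      by (simp add: smult_closed a_minus_def add.inv_solve_right')
    finally show ?thesis .
  qed
  note cdg_iff = this
  have graded: "graded_hom B 0 (S i) N =
      {free_map B N i x y | x y. x \<in> grade N (- i) \<and> y \<in> grade N (1 - i)}"
    using graded_hom_splitting_module[of 0 i] by simp
  have "carrier (cdg_hom B (S i) N) = {free_map B N i x y | x y. (x \<in> grade N (- i) \<and> y \<in> grade N (1 - i)) \<and>
      (\<forall>z\<in>carrier (S i). free_map B N i x y (pdiff (S i) z) = pdiff N (free_map B N i x y z))}"
    unfolding cdg_hom_def partial_object.simps graded by (rule sep_Collect2)
  also have "\<dots> = {free_map B N i x y | x y. x \<in> grade N (- i) \<and> y \<in> grade N (1 - i) \<and>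
      pdiff N x = sgn_mult N i (\<psi> \<odot> y) \<and> pdiff N y = sgn_mult N i (\<phi> \<odot> x)}"
    by (rule Collect2_cong) (use cdg_iff in auto)
  finally show ?thesis .
qed

lemma null_homotopic_splitting_module:
  "null_homotopic B (S i) N =
    {free_map B N i (pdiff N u \<oplus> sgn_mult N i (\<psi> \<odot> v)) (pdiff N v \<oplus> sgn_mult N i (\<phi> \<odot> u)) | u v.
      u \<in> grade N (- i - 1) \<and> v \<in> grade N (- i)}"
proof -
  have "(\<lambda>z\<in>carrier (S i). pdiff N (free_map B N (i - 1) u v z) \<oplus> free_map B N (i - 1) u v (pdiff (S i) z)) =
      free_map B N i (pdiff N u \<oplus> sgn_mult N i (\<psi> \<odot> v)) (pdiff N v \<oplus> sgn_mult N i (\<phi> \<odot> u))"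
      (is "?l = ?r")
    if "u \<in> grade N (- i - 1)" "v \<in> grade N (- i)" for u v
  proof
    fix z
    have [simp]: "u \<in> carrier N" "v \<in> carrier N"
      using that grade_closed by auto
    have sign: "\<ominus> sgn_mult N (i - 1) x = sgn_mult N i x" "sgn_mult N (2 * i - 1) x = \<ominus> x"
      if "x \<in> carrier N" for x
      using that by (auto simp: sgn_mult_def)
    show "?l z = ?r z"
    proof (cases "z \<in> carrier B \<times> carrier B")
      case True
      let ?h = "free_map B N (i - 1) u v (pdiff (S i) z)"
      have h: "?h \<in> carrier N"
        using pdiff_shift_splitting_closed[OF True] by simp
      have r: "?r z \<in> carrier N"
        using True by (simp add: smult_closed)
      have "pdiff N (free_map B N (i - 1) u v z) = \<ominus> ?h \<oplus> ?r z"
        using pdiff_free_map[of u v z "i - 1" i] True h by (simp add: sign a_minus_def smult_closed)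
      moreover have "(\<ominus> ?h \<oplus> ?r z) \<oplus> ?h = (?h \<oplus> \<ominus> ?h) \<oplus> ?r z"
        using h r by (simp add: a_ac)
      ultimately show ?thesis
        using True h r by (simp add: shift_splitting_simps r_neg)
    next
      case False
      then show ?thesis
        by (simp add: shift_splitting_simps free_map_def restrict_def)
    qed
  qed
  note homotopy = this
  have "graded_hom B (- 1) (S i) N =
      {free_map B N (i - 1) u v | u v. u \<in> grade N (- i - 1) \<and> v \<in> grade N (- i)}"
    using graded_hom_splitting_module[of "- 1" i] by (simp add: minus_diff_commute)
  then have "null_homotopic B (S i) N =
      {\<lambda>z\<in>carrier (S i). pdiff N (free_map B N (i - 1) u v z) \<oplus> free_map B N (i - 1) u v (pdiff (S i) z)
        | u v. u \<in> grade N (- i - 1) \<and> v \<in> grade N (- i)}"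
    unfolding null_homotopic_def by (simp only: image_Collect2)
  also have "\<dots> = {free_map B N i (pdiff N u \<oplus> sgn_mult N i (\<psi> \<odot> v)) (pdiff N v \<oplus> sgn_mult N i (\<phi> \<odot> u)) | u v.
      u \<in> grade N (- i - 1) \<and> v \<in> grade N (- i)}"
    by (rule Collect2_cong) (use homotopy in auto)
  finally show ?thesis .
qed

end

section \<open>Vanishing in the homotopy category\<close>

text \<open>
  The quotient consists of the cosets of \<open>H\<close>, and \<open>H\<close> is its unit. If the coset of \<open>g\<close> is \<open>H\<close>, then
  \<open>g = \<one> \<otimes> g\<close> lies in \<open>H\<close>; conversely right multiplication by \<open>g \<in> H\<close> permutes \<open>H\<close>. The hypotheses
  are conditions on products of two elements, which for null homotopic maps can be read off from
  their values on generators.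
\<close>

lemma FactGroup_trivial_iff:
  fixes G (structure)
  assumes one_closed: "\<one> \<in> carrier G"
    and l_one: "\<And>g. g \<in> carrier G \<Longrightarrow> \<one> \<otimes> g = g"
    and one: "\<one> \<in> H"
    and mult: "\<And>h g. \<lbrakk>h \<in> H; g \<in> H\<rbrakk> \<Longrightarrow> h \<otimes> g \<in> H"
    and div: "\<And>h g. \<lbrakk>h \<in> H; g \<in> H\<rbrakk> \<Longrightarrow> \<exists>h'\<in>H. h' \<otimes> g = h"
  shows "carrier (G Mod H) = {\<one>\<^bsub>G Mod H\<^esub>} \<longleftrightarrow> carrier G \<subseteq> H"
proof
  assume trivial: "carrier (G Mod H) = {\<one>\<^bsub>G Mod H\<^esub>}"
  show "carrier G \<subseteq> H"
  proof
    fix g assume g: "g \<in> carrier G"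
    then have "H #> g = H"
      using trivial by (auto simp: FactGroup_def RCOSETS_def)
    moreover have "\<one> \<otimes> g \<in> H #> g"
      using one by (auto simp: r_coset_def)
    ultimately show "g \<in> H"
      using l_one[OF g] by simp
  qed
next
  assume sub: "carrier G \<subseteq> H"
  have "H #> g = H" if "g \<in> carrier G" for g
  proof -
    have g: "g \<in> H" using sub that by blast
    show ?thesis
      unfolding r_coset_def using mult[OF _ g] div[OF _ g] by blast
  qed
  then show "carrier (G Mod H) = {\<one>\<^bsub>G Mod H\<^esub>}"
    using one_closed by (auto simp: FactGroup_def RCOSETS_def)
qed

context splitting_target
begin

lemma free_map_add:
  assumes "x \<in> carrier N" "y \<in> carrier N" "x' \<in> carrier N" "y' \<in> carrier N"
  shows "free_map B N n x y \<otimes>\<^bsub>cdg_hom B (S i) N\<^esub> free_map B N n x' y' =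
    free_map B N n (x \<oplus> x') (y \<oplus> y')"
proof
  fix z
  show "(free_map B N n x y \<otimes>\<^bsub>cdg_hom B (S i) N\<^esub> free_map B N n x' y') z =
      free_map B N n (x \<oplus> x') (y \<oplus> y') z"
  proof (cases "z \<in> carrier B \<times> carrier B")
    case True
    then show ?thesis
      using assms by (auto simp: cdg_hom_def shift_splitting_simps free_map_apply smult_r_distr
          smult_closed a_ac)
  next
    case False
    then show ?thesis
      by (simp add: cdg_hom_def shift_splitting_simps free_map_def restrict_def)
  qed
qed

lemma free_map_zero: "free_map B N n \<zero> \<zero> = \<one>\<^bsub>cdg_hom B (S i) N\<^esub>"
  by (auto simp: fun_eq_iff cdg_hom_def shift_splitting_simps free_map_def restrict_def)

lemma free_map_inject:
  assumes "x \<in> carrier N" "y \<in> carrier N" "x' \<in> carrier N" "y' \<in> carrier N"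
  shows "free_map B N n x y = free_map B N n x' y' \<longleftrightarrow> x = x' \<and> y = y'"
  using free_map_generators[OF assms(1,2), of n] free_map_generators[OF assms(3,4), of n] by metis

text \<open>
  Morphisms and null homotopic maps are both parametrised additively and faithfully by values on the
  generators, so the quotient vanishes when each pair that solves the equations of a morphism is a
  boundary \<open>(D u v, E u v)\<close>.
\<close>

lemma homotopy_hom_trivial_iff:
  "carrier (homotopy_hom B (S i) N) = {\<one>\<^bsub>homotopy_hom B (S i) N\<^esub>} \<longleftrightarrow>
    (\<forall>x\<in>grade N (- i). \<forall>y\<in>grade N (1 - i).
      pdiff N x = sgn_mult N i (\<psi> \<odot> y) \<and> pdiff N y = sgn_mult N i (\<phi> \<odot> x) \<longrightarrow>
      (\<exists>u\<in>grade N (- i - 1). \<exists>v\<in>grade N (- i).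
        x = pdiff N u \<oplus> sgn_mult N i (\<psi> \<odot> v) \<and> y = pdiff N v \<oplus> sgn_mult N i (\<phi> \<odot> u)))"
proof -
  let ?G = "cdg_hom B (S i) N" and ?H = "null_homotopic B (S i) N"
  define D where "D u v = pdiff N u \<oplus> sgn_mult N i (\<psi> \<odot> v)" for u v
  define E where "E u v = pdiff N v \<oplus> sgn_mult N i (\<phi> \<odot> u)" for u v
  have DE_closed [simp]: "D u v \<in> carrier N" "E u v \<in> carrier N"
    if "u \<in> carrier N" "v \<in> carrier N" for u v
    using that by (simp_all add: D_def E_def smult_closed)
  have DE_add: "D (u \<oplus> u') (v \<oplus> v') = D u v \<oplus> D u' v'" "E (u \<oplus> u') (v \<oplus> v') = E u v \<oplus> E u' v'"
    if "u \<in> carrier N" "v \<in> carrier N" "u' \<in> carrier N" "v' \<in> carrier N" for u v u' v'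
    using that by (simp_all add: D_def E_def pdiff_add smult_r_distr sgn_mult_add smult_closed a_ac)
  have DE_zero: "D \<zero> \<zero> = \<zero>" "E \<zero> \<zero> = \<zero>"
    by (simp_all add: D_def E_def)
  have H: "?H = {free_map B N i (D u v) (E u v) | u v. u \<in> grade N (- i - 1) \<and> v \<in> grade N (- i)}"
    unfolding null_homotopic_splitting_module D_def E_def ..
  have HI: "free_map B N i (D u v) (E u v) \<in> ?H"
    if "u \<in> grade N (- i - 1)" "v \<in> grade N (- i)" for u v
    unfolding H using that by blast
  have HE: "\<exists>u v. u \<in> grade N (- i - 1) \<and> v \<in> grade N (- i) \<and> h = free_map B N i (D u v) (E u v)"
    if "h \<in> ?H" for h
    using that unfolding H by blast
  have G_one: "\<one>\<^bsub>?G\<^esub> \<in> carrier ?G"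
  proof -
    have "free_map B N i \<zero> \<zero> \<in> carrier ?G"
      unfolding carrier_cdg_hom_splitting_module mem_Collect_eq
      by (rule exI[of _ \<zero>], rule exI[of _ \<zero>]) simp
    then show ?thesis
      by (simp only: free_map_zero[of i i])
  qed
  have "carrier (?G Mod ?H) = {\<one>\<^bsub>?G Mod ?H\<^esub>} \<longleftrightarrow> carrier ?G \<subseteq> ?H"
  proof (rule FactGroup_trivial_iff[OF G_one])
    fix g assume "g \<in> carrier ?G"
    then obtain x y where "x \<in> grade N (- i)" "y \<in> grade N (1 - i)" "g = free_map B N i x y"
      unfolding carrier_cdg_hom_splitting_module by blast
    then show "\<one>\<^bsub>?G\<^esub> \<otimes>\<^bsub>?G\<^esub> g = g"
      using free_map_add[of \<zero> \<zero> x y i i] by (simp add: free_map_zero[of i i, symmetric] grade_closed)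
  next
    show "\<one>\<^bsub>?G\<^esub> \<in> ?H"
      using HI[OF zero_grade zero_grade] by (simp only: DE_zero free_map_zero[of i i])
  next
    fix h g assume "h \<in> ?H" "g \<in> ?H"
    obtain u v where uv: "u \<in> grade N (- i - 1)" "v \<in> grade N (- i)" and h: "h = free_map B N i (D u v) (E u v)"
      using HE[OF \<open>h \<in> ?H\<close>] by blast
    obtain u' v' where uv': "u' \<in> grade N (- i - 1)" "v' \<in> grade N (- i)" and g: "g = free_map B N i (D u' v') (E u' v')"
      using HE[OF \<open>g \<in> ?H\<close>] by blast
    note closed [simp] = uv[THEN grade_closed] uv'[THEN grade_closed]
    have mult_g: "free_map B N i (D u v) (E u v) \<otimes>\<^bsub>?G\<^esub> g =
        free_map B N i (D (u \<oplus> u') (v \<oplus> v')) (E (u \<oplus> u') (v \<oplus> v'))"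
      if "u \<in> carrier N" "v \<in> carrier N" for u v
      unfolding g using that by (simp add: free_map_add DE_add)
    show "h \<otimes>\<^bsub>?G\<^esub> g \<in> ?H"
      using HI uv uv' by (simp add: h mult_g add_grade)
    \<comment> \<open>The boundary of the difference of the homotopies divides \<open>h\<close> by \<open>g\<close>.\<close>
    let ?h = "free_map B N i (D (u \<ominus> u') (v \<ominus> v')) (E (u \<ominus> u') (v \<ominus> v'))"
    have "?h \<otimes>\<^bsub>?G\<^esub> g = h"
      unfolding h by (subst mult_g) (simp_all add: a_minus_def a_assoc l_neg)
    moreover have "?h \<in> ?H"
      using HI uv uv' by (simp add: a_minus_def add_grade neg_grade)
    ultimately show "\<exists>h'\<in>?H. h' \<otimes>\<^bsub>?G\<^esub> g = h"
      by blast
  qed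
  also have "\<dots> \<longleftrightarrow> (\<forall>x\<in>grade N (- i). \<forall>y\<in>grade N (1 - i).
      pdiff N x = sgn_mult N i (\<psi> \<odot> y) \<and> pdiff N y = sgn_mult N i (\<phi> \<odot> x) \<longrightarrow>
      free_map B N i x y \<in> ?H)"
    unfolding carrier_cdg_hom_splitting_module by blast
  also have "\<dots> \<longleftrightarrow> (\<forall>x\<in>grade N (- i). \<forall>y\<in>grade N (1 - i).
      pdiff N x = sgn_mult N i (\<psi> \<odot> y) \<and> pdiff N y = sgn_mult N i (\<phi> \<odot> x) \<longrightarrow>
      (\<exists>u\<in>grade N (- i - 1). \<exists>v\<in>grade N (- i). x = D u v \<and> y = E u v))"
  proof -
    have "free_map B N i x y \<in> ?H \<longleftrightarrow>
        (\<exists>u\<in>grade N (- i - 1). \<exists>v\<in>grade N (- i). x = D u v \<and> y = E u v)"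
      if "x \<in> grade N (- i)" "y \<in> grade N (1 - i)" for x y
    proof -
      have "free_map B N i x y = free_map B N i (D u v) (E u v) \<longleftrightarrow> x = D u v \<and> y = E u v"
        if "u \<in> grade N (- i - 1)" "v \<in> grade N (- i)" for u v
        by (rule free_map_inject) (use that \<open>x \<in> _\<close> \<open>y \<in> _\<close> grade_closed in auto)
      then show ?thesis
        using HE HI by blast
    qed
    then show ?thesis
      by simp
  qed
  finally show ?thesis
    unfolding homotopy_hom_def D_def E_def .
qed

end

theorem proposition4p12:
  fixes K :: "'k ring" and A :: "('k, 'a) cdg_algebra" and \<phi> :: 'a
    and N :: "('a, 'm) pdg_module"
  assumes "dg_algebra K A"
    and "\<phi> \<in> grade A 2"
    and "\<And>a. a \<in> carrier A \<Longrightarrow> \<phi> \<otimes>\<^bsub>A\<^esub> a = a \<otimes>\<^bsub>A\<^esub> \<phi>"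
    and "pdiff A \<phi> = \<zero>\<^bsub>A\<^esub>"
    and "cdg_module A N"
  shows "splitting_acyclic A \<phi> \<zero>\<^bsub>A\<^esub> N \<longleftrightarrow>
    splitting_acyclic (curved_dual A \<phi>) (\<phi>, \<zero>\<^bsub>A\<^esub>) (eps A) (restrict_scalars fst N)"
proof -
  interpret A: dg_algebra K A by fact
  interpret N: cdg_module A N by fact
  interpret D: cdg_ring "curved_dual A \<phi>"
    by (rule cdg_ring_curved_dual[OF A.cdg_ring_axioms A.curv_zero assms(2-4)])
  interpret restricted: cdg_module "curved_dual A \<phi>" "restrict_scalars fst N"
    by (rule cdg_module_restrict_scalars[OF D.cdg_ring_axioms N.cdg_module_axioms])
       (auto simp: curved_dual_simps A.curv_zero)
  interpret original: splitting_target A N \<phi> "\<zero>\<^bsub>A\<^esub>"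
    by unfold_locales (simp_all add: assms(2))
  interpret restricted: splitting_target "curved_dual A \<phi>" "restrict_scalars fst N" "(\<phi>, \<zero>\<^bsub>A\<^esub>)" "eps A"
    by unfold_locales (simp_all add: curved_dual_simps eps_def assms(2) A.grade_one)
  have simps: "carrier (restrict_scalars fst N) = carrier N" "zero (restrict_scalars fst N) = zero N"
    "add (restrict_scalars fst N) = add N" "smult (restrict_scalars fst N) = (\<lambda>b x. fst b \<odot>\<^bsub>N\<^esub> x)"
    "grade (restrict_scalars fst N) = grade N" "pdiff (restrict_scalars fst N) = pdiff N"
    by (simp_all add: restrict_scalars_def)
  have sgn: "sgn_mult (restrict_scalars fst N) i x = sgn_mult N i x" for i x
    by (simp add: sgn_mult_def a_inv_def m_inv_def simps)
  \<comment> \<open>Both \<open>\<psi> = 0\<close> and the first coordinate 0 of \<open>eps A\<close> annihilate \<open>N\<close>, so the two criteria coincide.\<close>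
  show ?thesis
    unfolding splitting_acyclic_def original.homotopy_hom_trivial_iff restricted.homotopy_hom_trivial_iff
    by (simp add: simps sgn eps_def)
qed

end
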